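(* For $n\ge 1$, let $u_n, v_n, w_n, x_n, y_n$ denote the numbers of solutions of size $n+2$ of $(E_{T^{-1}})$, $(E_{TS})$, $(E_{ST})$, $(E_{TSTS})$ and $(E_{STST})$ respectively. Then: (i) $u_{n}=Q_{n}-V_{1,n}$ for all $n\ge 1$. (ii) $v_{1}=0$ and, for $n \geq 2$, $v_{n}=Q_{n-1}+\mathcal{S}_{n}$. (iii) For all $n\ge 1$, $w_{n}=Q_{n}-2 \left(\sum_{k=1}^{n} W_{1,k,n}\right)+W_{1,1,n}$, where the numbers $W_{1,k,n}$ are given by $W_{1,1,0}=0$, $W_{1,1,1}=1$, \[W_{1,1}(X)=\sum_{n=0}^{+\infty} W_{1,1,n} X^{n}=X+\sum_{n=2}^{+\infty}\left(\sum_{j=1}^{\left\lfloor\frac{n-1}{3}\right\rfloor} \sum_{k=0}^{\left\lfloor\frac{n-3j-1}{3}\right\rfloor} \frac{3j}{n-1-k} \binom{n-3j-2k-2}{k}\binom{2n-3j-4k-3}{n-3j-3k-1}\right) X^{n},\] and, for $k \geq 1$, $\sum_{n=0}^{+\infty} W_{1,k,n} X^{n}=W_{1,1}(X)\,(1-P^{-1}(X))^{k-1}$. (iv) $x_{n}=V_{1,n+1}$ for all $n\ge 1$. (v) $y_{1}=y_{2}=y_{3}=0$ and, for $n \geq 4$, $y_{n}=\sum_{d=3}^{n-1} (d-2) V_{d,n-1}$.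
   Context: Let $S=\begin{pmatrix}0&-1\\1&0\end{pmatrix}$ and $T=\begin{pmatrix}1&1\\0&1\end{pmatrix}$. For $n\ge 1$ and integers $a_1,\ldots,a_n$, set \[M_n(a_1,\ldots,a_n):=\begin{pmatrix} a_n & -1\\ 1 & 0\end{pmatrix}\begin{pmatrix} a_{n-1} & -1\\ 1 & 0\end{pmatrix}\cdots\begin{pmatrix} a_1 & -1\\ 1 & 0\end{pmatrix}\in SL_2(\mathbb{Z}).\] For $M\in SL_2(\mathbb{Z})$, a solution of $(E_M)$ of size $n$ is an $n$-tuple $(a_1,\ldots,a_n)$ of positive integers such that $M_n(a_1,\ldots,a_n)=\pm M$. A $\lambda$-quiddity is a solution of $(E_{Id})$. $Q_0:=1$ and, for $n\ge1$, $Q_n$ is the number of $\lambda$-quiddities of size $n+2$. For $n,k\ge 1$, $V_{k,n}$ is the number of $\lambda$-quiddities of size $n+2$ whose last component equals $k$. For $n\ge 0$, $\mathcal{S}_n$ is the number of solutions of $(E_S)$ of size $n+2$. Binomial conventions: $\binom{n}{k}=0$ if $k>n\ge 0$, $\binom{n}{-1}=0$ for $n \geq 0$, and a binomial coefficient $\binom{-n}{k}$ with negative upper entry ($n\ge 1$, $k \geq 0$) is taken to be $1$. Empty sums are $0$. $P_0:=1$ and, for $n\ge 1$, $P_{n}:=\sum_{k=0}^{\lfloor n/3\rfloor} \frac{1}{n-k+1} \binom{n-2k-1}{k}\binom{2n-4k}{n-3k}$. $P:=\sum_{n\ge 0} P_n X^n$, and $P^{-1}$ is the multiplicative inverse of $P$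 in $\mathbb{Z}[[X]]$. *)

theory Defs
  imports "HOL-Analysis.Analysis" "HOL-Computational_Algebra.Formal_Power_Series"
begin

definition mat2 :: "int \<Rightarrow> int \<Rightarrow> int \<Rightarrow> int \<Rightarrow> int^2^2" where
  "mat2 a b c d = vector [vector [a, b], vector [c, d]]"

definition S_mat :: "int^2^2" where
  "S_mat = mat2 0 (-1) 1 0"

definition T_mat :: "int^2^2" where
  "T_mat = mat2 1 1 0 1"

text \<open>A tuple \<open>(a\<^sub>1, \<dots>, a\<^sub>n)\<close> is the list \<open>[a\<^sub>1, \<dots>, a\<^sub>n]\<close>; the factor of \<open>a\<^sub>1\<close> is the rightmost one.\<close>

fun M_prod :: "int list \<Rightarrow> int^2^2" where
  "M_prod [] = mat 1"
| "M_prod (a # as) = M_prod as ** mat2 a (-1) 1 0"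

definition solutions :: "int^2^2 \<Rightarrow> nat \<Rightarrow> int list set" where
  "solutions M n =
     {as. length as = n \<and> (\<forall>a\<in>set as. 0 < a) \<and> (M_prod as = M \<or> M_prod as = - M)}"

abbreviation quiddities :: "nat \<Rightarrow> int list set" where
  "quiddities n \<equiv> solutions (mat 1) n"

definition Q :: "nat \<Rightarrow> nat" where
  "Q n = (if n = 0 then 1 else card (quiddities (n + 2)))"

definition V :: "nat \<Rightarrow> nat \<Rightarrow> nat" where
  "V k n = card {as \<in> quiddities (n + 2). last as = int k}"

definition S_count :: "nat \<Rightarrow> nat" where
  "S_count n = card (solutions S_mat (n + 2))"

text \<open>Binomial coefficients with the convention that a negative upper entry (and
  nonnegative lower entry) gives 1; this differs from \<open>gchoose\<close>.\<close>

definition binom :: "int \<Rightarrow> int \<Rightarrow> nat" where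
  "binom n k = (if k < 0 then 0 else if n < 0 then 1 else nat n choose nat k)"

text \<open>The series are taken with rational coefficients. As the constant coefficient of
  \<open>P_fps\<close> is 1, its inverse there is also its inverse over the integers as soon as the
  coefficients are integers.\<close>

definition P_coeff :: "nat \<Rightarrow> rat" where
  "P_coeff n = (if n = 0 then 1 else
     (\<Sum>k = 0..n div 3.
        1 / (of_nat n - of_nat k + 1)
        * of_nat (binom (int n - 2 * int k - 1) (int k))
        * of_nat (binom (2 * int n - 4 * int k) (int n - 3 * int k))))"

definition P_fps :: "rat fps" where
  "P_fps = Abs_fps P_coeff"

definition W11_coeff :: "nat \<Rightarrow> rat" where
  "W11_coeff n = (if n = 0 then 0 else if n = 1 then 1 else
     (\<Sum>j = 1..(n - 1) div 3. \<Sum>k = 0..(n - 3 * j - 1) div 3.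
        (3 * of_nat j) / (of_nat n - 1 - of_nat k)
        * of_nat (binom (int n - 3 * int j - 2 * int k - 2) (int k))
        * of_nat (binom (2 * int n - 3 * int j - 4 * int k - 3)
                        (int n - 3 * int j - 3 * int k - 1))))"

text \<open>\<open>W1 k n\<close> is \<open>W\<^bsub>1,k,n\<^esub>\<close>, meant for \<open>k \<ge> 1\<close>.\<close>

definition W1 :: "nat \<Rightarrow> nat \<Rightarrow> rat" where
  "W1 k n = fps_nth (Abs_fps W11_coeff * (1 - inverse P_fps) ^ (k - 1)) n"


text \<open>Every solution set is finite, so the cardinalities above are genuine counts.\<close>

lemma mat2_nth [simp]:
  "mat2 a b c d $ 1 $ 1 = a" "mat2 a b c d $ 1 $ 2 = b"
  "mat2 a b c d $ 2 $ 1 = c" "mat2 a b c d $ 2 $ 2 = d"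
  by (simp_all add: mat2_def)

lemma mat2_eqI:
  fixes X Y :: "int^2^2"
  assumes "X $ 1 $ 1 = Y $ 1 $ 1" "X $ 1 $ 2 = Y $ 1 $ 2"
    "X $ 2 $ 1 = Y $ 2 $ 1" "X $ 2 $ 2 = Y $ 2 $ 2"
  shows "X = Y"
  using assms by (simp add: vec_eq_iff forall_2)

lemma mat2_mult_nth [simp]:
  fixes X Y :: "int^2^2"
  shows "(X ** Y) $ i $ j = X $ i $ 1 * Y $ 1 $ j + X $ i $ 2 * Y $ 2 $ j"
  by (simp add: matrix_matrix_mult_def sum_2)

lemma mat_1_nth [simp]:
  "(mat 1 :: int^2^2) $ 1 $ 1 = 1" "(mat 1 :: int^2^2) $ 1 $ 2 = 0"
  "(mat 1 :: int^2^2) $ 2 $ 1 = 0" "(mat 1 :: int^2^2) $ 2 $ 2 = 1"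
  by (simp_all add: mat_def)

lemma matrix_inv_T_mat: "matrix_inv T_mat = mat2 1 (-1) 0 1"
proof -
  let ?R = "mat2 1 (-1) 0 1"
  have R: "T_mat ** ?R = mat 1" "?R ** T_mat = mat 1"
    by (rule mat2_eqI; simp add: T_mat_def)+
  have "\<exists>A. T_mat ** A = mat 1 \<and> A ** T_mat = mat 1"
    using R by blast
  then have "T_mat ** matrix_inv T_mat = mat 1 \<and> matrix_inv T_mat ** T_mat = mat 1"
    unfolding matrix_inv_def by (rule someI_ex)
  then have inv: "T_mat ** matrix_inv T_mat = mat 1" ..
  have "matrix_inv T_mat = (?R ** T_mat) ** matrix_inv T_mat"
    by (simp only: R matrix_mul_lid)
  also have "\<dots> = ?R ** (T_mat ** matrix_inv T_mat)"
    by (simp only: matrix_mul_assoc)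
  also have "\<dots> = ?R"
    by (simp only: inv matrix_mul_rid)
  finally show ?thesis .
qed

lemma M_prod_append: "M_prod (xs @ ys) = M_prod ys ** M_prod xs"
  by (induction xs) (simp_all add: matrix_mul_assoc)

lemma M_prod_ge_2:
  assumes "\<forall>x\<in>set xs. 2 \<le> x"
  defines "X \<equiv> M_prod xs"
  shows "1 \<le> X$1$1" "1 \<le> X$1$1 + X$1$2" "X$1$2 \<le> 0"
    "0 \<le> X$2$1" "0 \<le> X$2$1 + X$2$2"
    "X$2$1 \<le> X$1$1" "X$2$1 + X$2$2 \<le> X$1$1 + X$1$2" "\<forall>x\<in>set xs. x \<le> X$1$1"
proof -
  have "1 \<le> M_prod xs$1$1 \<and> 1 \<le> M_prod xs$1$1 + M_prod xs$1$2 \<and> M_prod xs$1$2 \<le> 0 \<and>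
    0 \<le> M_prod xs$2$1 \<and> 0 \<le> M_prod xs$2$1 + M_prod xs$2$2 \<and>
    M_prod xs$2$1 \<le> M_prod xs$1$1 \<and>
    M_prod xs$2$1 + M_prod xs$2$2 \<le> M_prod xs$1$1 + M_prod xs$1$2 \<and>
    (\<forall>x\<in>set xs. x \<le> M_prod xs$1$1)"
    using assms(1)
  proof (induction xs)
    case Nil
    then show ?case by simp
  next
    case (Cons x xs)
    define a b c d where abcd: "a = M_prod xs$1$1" "b = M_prod xs$1$2"
      "c = M_prod xs$2$1" "d = M_prod xs$2$2"
    have x: "2 \<le> x" and IH: "1 \<le> a" "1 \<le> a + b" "b \<le> 0" "0 \<le> c" "0 \<le> c + d" "c \<le> a"
      "c + d \<le> a + b" "\<forall>x\<in>set xs. x \<le> a"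
      using Cons unfolding abcd by auto
    have "0 \<le> (x - 2) * (a - 1)" "0 \<le> (x - 2) * c" "0 \<le> (x - 2) * (a - c)"
      using x IH(1,4,6) by simp_all
    then have xa: "x - 2 \<le> x * a - 2 * a" and xc: "0 \<le> x * c - 2 * c"
      and xac: "x * c - 2 * c \<le> x * a - 2 * a"
      by (simp_all add: algebra_simps)
    have "x \<le> x * a + b" "a \<le> x * a + b" "1 \<le> x * a + b" "1 \<le> x * a + b - a"
      using xa IH(1-3) x by simp_all
    moreover from this(1,2) have "\<forall>y\<in>set (x # xs). y \<le> x * a + b"
      using IH(8) by force
    moreover have "0 \<le> x * c + d" "0 \<le> x * c + d - c"
      using xc IH(4,5) by simp_all
    moreover have "x * c + d \<le> x * a + b" "x * c + d - c \<le> x * a + b - a"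
      using xac IH(6,7) by simp_all
    ultimately show ?case
      using IH(1,4) by (simp add: abcd[symmetric] mult.commute)
  qed
  then show "1 \<le> X$1$1" "1 \<le> X$1$1 + X$1$2" "X$1$2 \<le> 0"
    "0 \<le> X$2$1" "0 \<le> X$2$1 + X$2$2"
    "X$2$1 \<le> X$1$1" "X$2$1 + X$2$2 \<le> X$1$1 + X$1$2" "\<forall>x\<in>set xs. x \<le> X$1$1"
    unfolding X_def by blast+
qed

lemma M_prod_reduce_0: "M_prod (ps @ [p, 0, q] @ qs) = - M_prod (ps @ [p + q] @ qs)"
proof -
  have "M_prod [p, 0, q] = mat2 (-1) 0 0 (-1) ** M_prod [p + q]"
    by (rule mat2_eqI) simp_all
  then have "M_prod (ps @ [p, 0, q] @ qs) =
      M_prod qs ** (mat2 (-1) 0 0 (-1) ** M_prod [p + q]) ** M_prod ps"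
    by (simp only: M_prod_append)
  also have "\<dots> = - (M_prod qs ** M_prod [p + q] ** M_prod ps)"
    by (rule mat2_eqI) (simp_all add: algebra_simps)
  finally show ?thesis
    by (simp only: M_prod_append)
qed

lemma M_prod_reduce_1: "M_prod (ps @ [p, 1, q] @ qs) = M_prod (ps @ [p - 1, q - 1] @ qs)"
proof -
  have "M_prod [p, 1, q] = M_prod [p - 1, q - 1]"
    by (rule mat2_eqI) (simp_all add: algebra_simps)
  then show ?thesis
    by (simp only: M_prod_append)
qed

lemma interior_split:
  assumes "t \<in> set (butlast (tl ys))"
  obtains ps p q qs where "ys = ps @ [p, t, q] @ qs"
proof -
  obtain a zs where ys: "ys = a # zs"
    using assms by (cases ys) auto
  then obtain zs' b where zs: "zs = zs' @ [b]"
    using assms by (cases zs rule: rev_cases) auto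
  obtain us vs where uv: "zs' = us @ t # vs"
    using assms ys zs by (auto dest: split_list)
  obtain ps p where "a # us = ps @ [p]"
    by (metis list.distinct(1) rev_exhaust)
  moreover obtain q qs where "vs @ [b] = q # qs"
    by (metis Nil_is_append_conv list.distinct(1) neq_Nil_conv)
  ultimately have "ys = ps @ [p, t, q] @ qs"
    using ys zs uv by (metis append.assoc append_Cons append_Nil)
  then show thesis by (rule that)
qed

lemma M_prod_bound:
  "\<exists>B. \<forall>ys. length ys = n \<and> (\<forall>y\<in>set ys. - c \<le> y) \<and> (\<forall>y\<in>set (butlast (tl ys)). 0 \<le> y) \<and>
     (M_prod ys = M \<or> M_prod ys = - M) \<longrightarrow> (\<forall>y\<in>set ys. y \<le> B)"
  if "0 \<le> c" for c :: int
  using that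
proof (induction n arbitrary: c rule: less_induct)
  case (less n)
  let ?P = "\<lambda>n c ys. length ys = n \<and> (\<forall>y\<in>set ys. - c \<le> y) \<and>
     (\<forall>y\<in>set (butlast (tl ys)). 0 \<le> y) \<and> (M_prod ys = M \<or> M_prod ys = - M)"
  obtain B1 where B1: "n \<ge> 3 \<longrightarrow> (\<forall>ys. ?P (n - 2) (2 * c) ys \<longrightarrow> (\<forall>y\<in>set ys. y \<le> B1))"
    using less.IH[of "n - 2" "2 * c"] less.prems by (cases "n \<ge> 3") auto
  obtain B2 where B2: "n \<ge> 3 \<longrightarrow> (\<forall>ys. ?P (n - 1) (c + 1) ys \<longrightarrow> (\<forall>y\<in>set ys. y \<le> B2))"
    using less.IH[of "n - 1" "c + 1"] less.prems by (cases "n \<ge> 3") auto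
  define B where "B = max B1 0 + c + max B2 0 + 1 + \<bar>M$1$1\<bar> + \<bar>M$1$2\<bar> + \<bar>M$2$1\<bar> + \<bar>M$2$2\<bar>"
  have B: "B1 + c \<le> B" "B2 + 1 \<le> B" "\<bar>M$1$1\<bar> \<le> B" "\<bar>M$1$2\<bar> + \<bar>M$2$2\<bar> \<le> B"
    "\<bar>M$2$1\<bar> + \<bar>M$2$2\<bar> \<le> B" "\<bar>M$2$2\<bar> \<le> B"
    and one_le_B: "1 \<le> B"
  proof -
    have "\<exists>m1 m2 m3 m4 b1 b2. \<bar>M$1$1\<bar> = m1 \<and> \<bar>M$1$2\<bar> = m2 \<and> \<bar>M$2$1\<bar> = m3 \<and> \<bar>M$2$2\<bar> = m4 \<and>
       max B1 0 = b1 \<and> max B2 0 = b2 \<and>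
       0 \<le> m1 \<and> 0 \<le> m2 \<and> 0 \<le> m3 \<and> 0 \<le> m4 \<and> 0 \<le> b1 \<and> 0 \<le> b2 \<and> B1 \<le> b1 \<and> B2 \<le> b2"
      by simp
    then obtain m1 m2 m3 m4 b1 b2 where
      eqs: "\<bar>M$1$1\<bar> = m1" "\<bar>M$1$2\<bar> = m2" "\<bar>M$2$1\<bar> = m3" "\<bar>M$2$2\<bar> = m4"
        "max B1 0 = b1" "max B2 0 = b2"
      and pos: "0 \<le> m1" "0 \<le> m2" "0 \<le> m3" "0 \<le> m4" "0 \<le> b1" "0 \<le> b2" "B1 \<le> b1" "B2 \<le> b2"
      by blast
    show "B1 + c \<le> B" "B2 + 1 \<le> B" "\<bar>M$1$1\<bar> \<le> B" "\<bar>M$1$2\<bar> + \<bar>M$2$2\<bar> \<le> B"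
      "\<bar>M$2$1\<bar> + \<bar>M$2$2\<bar> \<le> B" "\<bar>M$2$2\<bar> \<le> B" "1 \<le> B"
      unfolding B_def eqs using pos less.prems by simp_all
  qed
  have "\<forall>y\<in>set ys. y \<le> B" if ys: "?P n c ys" for ys
  proof -
    consider (zero) "0 \<in> set (butlast (tl ys))"
      | (one) "0 \<notin> set (butlast (tl ys))" "1 \<in> set (butlast (tl ys))"
      | (big) "0 \<notin> set (butlast (tl ys))" "1 \<notin> set (butlast (tl ys))"
      by blast
    then show ?thesis
    proof cases
      case zero
      then obtain ps p q qs where eq: "ys = ps @ [p, 0, q] @ qs"
        by (rule interior_split)
      let ?zs = "ps @ [p + q] @ qs"
      have pq: "- c \<le> p" "- c \<le> q" "\<forall>y\<in>set ps \<union> set qs. - c \<le> y"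
        using ys eq by auto
      have n: "n \<ge> 3" "length ?zs = n - 2"
        using ys eq by auto
      have "\<forall>y\<in>set ?zs. - (2 * c) \<le> y"
        using pq less.prems by force
      moreover have "\<forall>y\<in>set (butlast (tl ?zs)). 0 \<le> y"
        using ys eq by (cases ps; cases qs rule: rev_cases) (auto simp: butlast_append)
      moreover have "M_prod ?zs = M \<or> M_prod ?zs = - M"
        using ys unfolding eq M_prod_reduce_0 by (metis minus_minus)
      ultimately have "\<forall>y\<in>set ?zs. y \<le> B1"
        using B1 n by blast
      then have "p + q \<le> B1" "\<forall>y\<in>set ps \<union> set qs. y \<le> B1"
        by auto
      moreover have "B1 \<le> B"
        using B(1) less.prems by simp
      ultimately have "\<forall>y\<in>set ps \<union> set qs. y \<le> B"
        by (meson order_trans)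
      moreover have "p \<le> B" "0 \<le> B" "q \<le> B"
        using \<open>p + q \<le> B1\<close> pq(1,2) B(1) one_le_B by simp_all
      ultimately show ?thesis
        unfolding eq by auto
    next
      case one
      then obtain ps p q qs where eq: "ys = ps @ [p, 1, q] @ qs"
        using interior_split by metis
      let ?zs = "ps @ [p - 1, q - 1] @ qs"
      have pq: "- c \<le> p" "- c \<le> q" "\<forall>y\<in>set ps \<union> set qs. - c \<le> y"
        using ys eq by auto
      have n: "n \<ge> 3" "length ?zs = n - 1"
        using ys eq by auto
      have "\<forall>y\<in>set ?zs. - (c + 1) \<le> y"
        using pq less.prems by force
      moreover have "\<forall>y\<in>set (butlast (tl ys)). 0 < y"
        using ys one(1) by (metis order_le_less)
      then have "\<forall>y\<in>set (butlast (tl ?zs)). 0 \<le> y"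
        using eq by (cases ps; cases qs rule: rev_cases) (auto simp: butlast_append less_imp_le)
      moreover have "M_prod ?zs = M \<or> M_prod ?zs = - M"
        using ys unfolding eq M_prod_reduce_1 by simp
      ultimately have "\<forall>y\<in>set ?zs. y \<le> B2"
        using B2 n by blast
      then have "p \<le> B2 + 1" "q \<le> B2 + 1" "\<forall>y\<in>set ps \<union> set qs. y \<le> B2"
        by auto
      moreover have "B2 \<le> B"
        using B(2) by simp
      ultimately have "\<forall>y\<in>set ps \<union> set qs. y \<le> B"
        by (meson order_trans)
      moreover have "p \<le> B" "1 \<le> B" "q \<le> B"
        using \<open>p \<le> B2 + 1\<close> \<open>q \<le> B2 + 1\<close> B(2) one_le_B by simp_all
      ultimately show ?thesis
        unfolding eq by auto
    next
      case big
      consider "ys = []" | a where "ys = [a]" | a xs b where "ys = a # xs @ [b]"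
        by (metis list.exhaust rev_exhaust)
      then show ?thesis
      proof cases
        case 1
        then show ?thesis by simp
      next
        case (2 a)
        then have "M_prod ys $ 1 $ 1 = a"
          by simp
        then have "\<bar>a\<bar> = \<bar>M$1$1\<bar>"
          using ys by auto
        then show ?thesis
          using 2 B(3) by simp
      next
        case (3 a xs b)
        have xs: "\<forall>x\<in>set xs. 2 \<le> x"
        proof
          fix x assume "x \<in> set xs"
          with big ys 3 have "x \<noteq> 0" "x \<noteq> 1" "0 \<le> x" by auto
          then show "2 \<le> x" by linarith
        qed
        define X where "X = M_prod xs"
        note X = M_prod_ge_2[OF xs, folded X_def]
        have Meq: "M_prod ys = mat2 b (-1) 1 0 ** X ** mat2 a (-1) 1 0"
          unfolding 3 X_def by (simp add: M_prod_append matrix_mul_assoc)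
        have m: "M_prod ys $ 2 $ 2 = - (X$1$1)" "M_prod ys $ 2 $ 1 = a * X$1$1 + X$1$2"
          "M_prod ys $ 1 $ 2 = - (b * X$1$1) + X$2$1"
          unfolding Meq by (simp_all add: mult.commute)
        have abs: "\<bar>M_prod ys $ i $ j\<bar> = \<bar>M $ i $ j\<bar>" for i j
          using ys by auto
        have m': "\<bar>X$1$1\<bar> = \<bar>M$2$2\<bar>" "\<bar>a * X$1$1 + X$1$2\<bar> = \<bar>M$2$1\<bar>"
          "\<bar>- (b * X$1$1) + X$2$1\<bar> = \<bar>M$1$2\<bar>"
          using abs[of 2 2] abs[of 2 1] abs[of 1 2] unfolding m by simp_all
        have le: "z \<le> \<bar>z * X$1$1\<bar>" for z
          using X(1) by (smt (verit, best) abs_mult mult_le_cancel_left1)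
        have tri: "\<bar>r\<bar> \<le> \<bar>r + s\<bar> + \<bar>s\<bar>" "\<bar>r\<bar> \<le> \<bar>- r + s\<bar> + \<bar>s\<bar>" for r s :: int
          by linarith+
        have "\<bar>X$1$2\<bar> \<le> \<bar>X$1$1\<bar>" "\<bar>X$2$1\<bar> \<le> \<bar>X$1$1\<bar>"
          using X(1-4,6) by linarith+
        with tri(1)[of "a * X$1$1" "X$1$2"] tri(2)[of "b * X$1$1" "X$2$1"]
        have "\<bar>a * X$1$1\<bar> \<le> \<bar>M$2$1\<bar> + \<bar>M$2$2\<bar>" "\<bar>b * X$1$1\<bar> \<le> \<bar>M$1$2\<bar> + \<bar>M$2$2\<bar>"
          unfolding m' by (meson add_left_mono order_trans)+
        then have "a \<le> B" "b \<le> B"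
          using le B(4,5) by (meson order_trans)+
        moreover have "\<forall>x\<in>set xs. x \<le> B"
        proof
          fix x assume "x \<in> set xs"
          then have "x \<le> X$1$1" using X(8) by blast
          then show "x \<le> B"
            using m'(1) B(6) X(1) by simp
        qed
        ultimately show ?thesis
          using 3 by auto
      qed
    qed
  qed
  then show ?case by blast
qed

lemma finite_solutions: "finite (solutions M n)"
proof -
  obtain B where B: "\<forall>ys. length ys = n \<and> (\<forall>y\<in>set ys. - 0 \<le> y) \<and>
     (\<forall>y\<in>set (butlast (tl ys)). 0 \<le> y) \<and> (M_prod ys = M \<or> M_prod ys = - M) \<longrightarrow>
     (\<forall>y\<in>set ys. y \<le> B)"
    using M_prod_bound[of 0 n M] by auto
  have "solutions M n \<subseteq> {ys. set ys \<subseteq> {0..B} \<and> length ys = n}"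
  proof
    fix ys assume ys: "ys \<in> solutions M n"
    then have pos: "\<forall>y\<in>set ys. 0 \<le> y"
      unfolding solutions_def by auto
    have "set (butlast (tl ys)) \<subseteq> set ys"
      by (metis in_set_butlastD list.set_sel(2) subsetI tl_Nil)
    then have "\<forall>y\<in>set (butlast (tl ys)). 0 \<le> y"
      using pos by blast
    with pos ys have "\<forall>y\<in>set ys. y \<le> B"
      using B[rule_format, of ys] unfolding solutions_def by auto
    then show "ys \<in> {ys. set ys \<subseteq> {0..B} \<and> length ys = n}"
      using pos ys unfolding solutions_def by auto
  qed
  then show ?thesis
    by (rule finite_subset) (simp add: finite_lists_length_eq)
qed

end

theory Submission
  imports Defs
begin

text \<open>
  Up to sign, \<open>U = T S\<close> has order 3, \<open>S\<close> has order 2, and every matrix is a unique reduced word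
  in \<open>U\<close> and \<open>S\<close>. A factor \<open>T\<^sup>a S\<close> is then \<open>U (S U)\<^sup>a\<^sup>-\<^sup>1\<close>, so a tuple is the same thing as a word in
  the two letters \<open>U\<close> and \<open>S U\<close> that begins with \<open>U\<close>, every letter \<open>U\<close> opening a new entry. Solutions
  of \<open>(E\<^sub>M)\<close> are therefore walks from 1 to \<open>M\<close> on the Cayley graph, a tree of triangles (cosets of the
  powers of \<open>U\<close>) joined by \<open>S\<close>-edges; the size is the number of letters \<open>U\<close>.

  Let \<open>X\<close> mark the letters \<open>U\<close>, and let \<open>t\<close> be the generating series of the ways to pass from one
  vertex of a triangle to the next, either at once or after an excursion through the \<open>S\<close>-edge of the
  vertex. On the far side of that edge the walk turns inside a new triangle, and a full round there
  that avoids the entry edge has series \<open>X t\<^sup>2\<close>. Hence \<open>t = X + t\<^sup>2 / (1 - X t\<^sup>2)\<close>. The walks to a matrix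
  factor along its reduced word: the starting triangle contributes \<open>X t\<^sup>p / (1 - t\<^sup>3)\<close> and each further
  triangle \<open>t\<^sup>p / (1 - X t\<^sup>2)\<close>, where \<open>p\<close> is the position reached in it. This is \<open>nsol_stack\<close>. It is
  not proved by decomposing walks: removing the last letter of the word gives a recurrence for the
  numbers of solutions (\<open>nsol_split_hd\<close>), the products satisfy the same one (\<open>weight_rec\<close>),
  and as both sides vanish far out in the tree, they agree.

  On the analytic side, \<open>X P\<close> solves the equation for \<open>t\<close>, and the coefficients of all powers of \<open>t\<close>
  have the closed form that Lagrange inversion predicts (\<open>edge_power_nth\<close>). So the double sum in (iii)
  is \<open>X / (1 - t\<^sup>3)\<close>, which counts the solutions for \<open>U\<close>, that is, the quiddities beginning and ending
  with 1 without these two entries. Since \<open>1 - (1 - P\<^sup>-\<^sup>1) = P\<^sup>-\<^sup>1\<close>, the geometric series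
  over \<open>k\<close> gives \<open>X P / (1 - t\<^sup>3)\<close>, which counts the quiddities that end with 1.

  The five identities then come from removing or decreasing the first and last entries. For
  example, \<open>w\<^sub>n\<close> counts the quiddities of size \<open>n + 2\<close> whose first and last entries both exceed 1, whence the
  inclusion-exclusion in (iii). In (v), stripping the first entry \<open>a\<close> leaves the quiddities of size
  \<open>n + 1\<close> with last entry \<open>d > a + 1\<close>, so each of them is obtained \<open>d - 2\<close> times.
\<close>

section \<open>The cubic equation of the series P\<close>

lemma fps_X_power_dvd_iff:
  "fps_X ^ n dvd (f :: 'a :: comm_ring_1 fps) \<longleftrightarrow> (\<forall>i<n. fps_nth f i = 0)"
proof
  assume "fps_X ^ n dvd f"
  then show "\<forall>i<n. fps_nth f i = 0"
    by (auto simp: dvd_def fps_X_power_mult_nth)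
next
  assume "\<forall>i<n. fps_nth f i = 0"
  then have "f = fps_X ^ n * fps_shift n f"
    by (intro fps_ext) (simp add: fps_X_power_mult_nth)
  then show "fps_X ^ n dvd f"
    by (metis dvd_triv_left)
qed

text \<open>
  In terms of \<open>p = t / X\<close> the equation reads \<open>p = 1 + X (p\<^sup>2 + X\<^sup>2 p\<^sup>3 - X\<^sup>2 p\<^sup>2)\<close>. The right-hand side is a
  contraction for the \<open>X\<close>-adic metric, so its iterates from 0 stabilise coefficientwise.
\<close>

lemma edge_equation_solvable:
  "\<exists>t :: rat fps. fps_nth t 0 = 0 \<and> (t - fps_X) * (1 - fps_X * t ^ 2) = t ^ 2"
proof -
  define F :: "rat fps \<Rightarrow> rat fps"
    where "F f = 1 + fps_X * (f ^ 2 + fps_X ^ 2 * f ^ 3 - fps_X ^ 2 * f ^ 2)" for f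
  define a where "a k = (F ^^ k) 0" for k
  have a_Suc: "a (Suc k) = F (a k)" for k
    by (simp add: a_def)
  have contract: "fps_X ^ Suc n dvd F f - F g" if "fps_X ^ n dvd f - g" for n f g
  proof -
    have "F f - F g = fps_X * ((f - g) * (f + g + fps_X ^ 2 * (f ^ 2 + f * g + g ^ 2)
        - fps_X ^ 2 * (f + g)))"
      by (simp add: F_def algebra_simps power2_eq_square power3_eq_cube)
    then show ?thesis
      using that by (simp add: mult_dvd_mono)
  qed
  have consec: "fps_X ^ k dvd a (Suc k) - a k" for k
  proof (induction k)
    case (Suc k)
    then show ?case
      using contract[of k "a (Suc k)" "a k"] by (simp only: a_Suc)
  qed simp
  have stable: "fps_X ^ k dvd a (k + j) - a k" for k j
  proof (induction j)
    case (Suc j)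
    have "fps_X ^ k dvd a (Suc (k + j)) - a (k + j)"
      using consec[of "k + j"] by (meson dvd_trans le_add1 le_imp_power_dvd)
    from dvd_add[OF this Suc] show ?case
      by simp
  qed simp
  define p where "p = Abs_fps (\<lambda>n. fps_nth (a (Suc n)) n)"
  have p: "fps_X ^ k dvd p - a k" for k
    unfolding fps_X_power_dvd_iff
  proof (intro allI impI)
    fix i assume "i < k"
    then have "fps_X ^ Suc i dvd a k - a (Suc i)"
      using stable[of "Suc i" "k - Suc i"] by simp
    then show "fps_nth (p - a k) i = 0"
      unfolding fps_X_power_dvd_iff by (simp add: p_def)
  qed
  have "fps_X ^ Suc k dvd p - F p" for k
  proof -
    have "fps_X ^ Suc k dvd F p - F (a k)"
      by (intro contract p)
    from dvd_diff[OF p[of "Suc k"] this] show ?thesis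
      by (simp add: a_Suc)
  qed
  then have "fps_nth (p - F p) n = 0" for n
    using fps_X_power_dvd_iff by blast
  then have pF: "p = F p"
    by (simp add: fps_eq_iff)
  let ?t = "fps_X * p"
  have "(?t - fps_X) * (1 - fps_X * ?t ^ 2) - ?t ^ 2 =
      fps_X * (p - F p) "
    by (simp add: F_def algebra_simps power2_eq_square power3_eq_cube)
  then have "(?t - fps_X) * (1 - fps_X * ?t ^ 2) = ?t ^ 2"
    using pF by simp
  then show ?thesis
    by (intro exI[of _ ?t]) simp
qed

text \<open>
  Treat \<open>y\<close> in \<open>t = z + t\<^sup>2 / (1 - y t\<^sup>2)\<close> as an independent parameter. Then \<open>t\<close> is the compositional inverse
  of \<open>t (1 - t / (1 - y t\<^sup>2))\<close>, and Lagrange inversion gives the coefficient of \<open>z\<^sup>n y\<^sup>k\<close> in \<open>t\<^sup>m\<close> as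
  \<open>m/n\<close> times \<open>(n+i-1 choose i) (i+k-1 choose k)\<close> with \<open>i = n - m - 2 k\<close>. Setting \<open>y = z\<close> makes \<open>N = n + k\<close> the
  total degree; \<open>edge_power_term\<close> is this coefficient. At \<open>i = k = 0\<close>
  truncated subtraction turns \<open>(-1 choose 0)\<close> into \<open>(0 choose 0) = 1\<close>, as it should.
\<close>

definition edge_power_term :: "nat \<Rightarrow> nat \<Rightarrow> nat \<Rightarrow> rat" where
  "edge_power_term m N k = (if m + 3 * k \<le> N then
     of_nat m / of_nat (N - k) * of_nat ((N - m - 2 * k - 1) choose k)
       * of_nat ((2 * N - m - 4 * k - 1) choose (N - m - 3 * k)) else 0)"

definition edge_power_coeff :: "nat \<Rightarrow> nat \<Rightarrow> rat" where
  "edge_power_coeff m N = (if N = 0 then of_bool (m = 0) else \<Sum>k\<le>N. edge_power_term m N k)"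

lemma choose_row_shift:
  "(of_nat b + 1) * of_nat ((a + b) choose Suc b) = (of_nat a :: rat) * of_nat ((a + b) choose b)"
proof -
  have "Suc b * ((a + b) choose Suc b) = a * ((a + b) choose b)"
    using binomial_absorb_comp[of "a + b" b] binomial_absorption[of b "a + b"] by simp
  then have "(of_nat (Suc b) :: rat) * of_nat ((a + b) choose Suc b) = of_nat a * of_nat ((a + b) choose b)"
    by (metis of_nat_mult)
  then show ?thesis
    by (simp add: add.commute)
qed

lemma edge_power_term_eq:
  assumes "N = m + 3 * k + i" "n = m + 2 * k + i" "a = i + k - 1" "b = n + i - 1"
  shows "edge_power_term m N k =
    of_nat m / of_nat n * of_nat (a choose k) * of_nat (b choose i)"
proof -
  have "N - k = n" "N - m - 2 * k - 1 = a" "2 * N - m - 4 * k - 1 = b" "N - m - 3 * k = i"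
    using assms by simp_all
  then show ?thesis
    using assms(1) by (simp add: edge_power_term_def)
qed

text \<open>
  Multiplying the equation by \<open>t\<^sup>m\<close> and clearing the denominator gives
  \<open>t\<^sup>m\<^sup>+\<^sup>1 + y z t\<^sup>m\<^sup>+\<^sup>2 = t\<^sup>m\<^sup>+\<^sup>2 + z t\<^sup>m + y t\<^sup>m\<^sup>+\<^sup>3\<close>. It holds separately in each power of \<open>y\<close>, hence
  term by term for the closed form; the terms with a factor \<open>y\<close> are absent for \<open>k = 0\<close>. Apart from
  degenerate cases, all terms are rational multiples of one product of two binomial coefficients.
\<close>

lemma edge_power_term_rec_0:
  assumes "2 \<le> N"
  shows "edge_power_term (m + 1) N 0 =
    edge_power_term (m + 2) N 0 + edge_power_term m (N - 1) 0"
proof (cases "m + 1 \<le> N")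
  case True
  then obtain i where N: "N = m + 1 + i"
    using le_Suc_ex by blast
  show ?thesis
  proof (cases i)
    case 0
    with assms N show ?thesis
      by (simp add: edge_power_term_def)
  next
    case (Suc j)
    define q where "q = m + j + 1"
    define b :: rat where "b = of_nat ((q + j) choose Suc j)"
    have q: "(of_nat q :: rat) > 0" "of_nat q = (of_nat m + of_nat j + 1 :: rat)"
      by (simp_all add: q_def)
    have d0: "of_nat ((q + j) choose j) = (of_nat j + 1) / of_nat q * b"
      using choose_row_shift[of j q] q(1) by (simp add: b_def field_simps)
    have d1: "of_nat (Suc (q + j) choose Suc j) = (of_nat q + of_nat j + 1) / of_nat q * b"
      using d0 q(1) by (simp add: b_def field_simps)
    have 1: "edge_power_term (m + 1) N 0 =
        of_nat (m + 1) / of_nat (Suc q) * of_nat (j choose 0) * of_nat (Suc (q + j) choose Suc j)"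
      by (rule edge_power_term_eq) (simp_all add: N Suc q_def)
    have 2: "edge_power_term (m + 2) N 0 =
        of_nat (m + 2) / of_nat (Suc q) * of_nat ((j - 1) choose 0) * of_nat ((q + j) choose j)"
      by (rule edge_power_term_eq) (simp_all add: N Suc q_def)
    have 3: "edge_power_term m (N - 1) 0 = of_nat m / of_nat q * of_nat (j choose 0) * b"
      unfolding b_def by (rule edge_power_term_eq) (simp_all add: N Suc q_def)
    show ?thesis
      unfolding 1 2 3 d0 d1 using q(1)
      by (simp add: divide_simps) (simp add: q(2) algebra_simps)
  qed
qed (auto simp: edge_power_term_def)

lemma edge_power_term_rec_Suc:
  assumes "2 \<le> N"
  shows "edge_power_term (m + 1) N (Suc k) + edge_power_term (m + 2) (N - 2) k =
    edge_power_term (m + 2) N (Suc k) + edge_power_term m (N - 1) (Suc k)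
      + edge_power_term (m + 3) (N - 1) k"
proof (cases "m + 1 + 3 * Suc k \<le> N")
  case True
  then obtain i where N: "N = m + 4 + 3 * k + i"
    using le_Suc_ex by (metis add.assoc mult_Suc_right numeral_plus_one add.commute
        semiring_norm(2,4,8) add.left_commute one_plus_numeral)
  show ?thesis
  proof (cases i)
    case 0
    with N show ?thesis
      by (cases k) (simp_all add: edge_power_term_def binomial_eq_0)
  next
    case (Suc j)
    define q where "q = m + 3 + 2 * k + j"
    define b E :: rat where "b = of_nat ((q + j) choose Suc j)" and "E = of_nat ((j + k) choose k)"
    have q: "(of_nat q :: rat) > 0" "of_nat q = (of_nat m + 3 + 2 * of_nat k + of_nat j :: rat)"
      by (simp_all add: q_def)
    have d0: "of_nat ((q + j) choose j) = (of_nat j + 1) / of_nat q * b"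
      using choose_row_shift[of j q] q(1) by (simp add: b_def field_simps)
    have d1: "of_nat (Suc (q + j) choose Suc j) = (of_nat q + of_nat j + 1) / of_nat q * b"
      using d0 q(1) by (simp add: b_def field_simps)
    have c0: "of_nat ((j + k) choose Suc k) = of_nat j / (of_nat k + 1) * E"
      using choose_row_shift[of k j] by (simp add: E_def field_simps add_pos_nonneg)
    have c1: "of_nat (Suc (j + k) choose Suc k) = (of_nat j + of_nat k + 1) / (of_nat k + 1) * E"
      using c0 by (simp add: E_def field_simps)
    have 1: "edge_power_term (m + 1) N (Suc k) = of_nat (m + 1) / of_nat (Suc q)
        * of_nat (Suc (j + k) choose Suc k) * of_nat (Suc (q + j) choose Suc j)"
      by (rule edge_power_term_eq) (simp_all add: N Suc q_def)
    have 2: "edge_power_term (m + 2) (N - 2) k = of_nat (m + 2) / of_nat q * E * b"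
      unfolding E_def b_def by (rule edge_power_term_eq) (simp_all add: N Suc q_def)
    have 3: "edge_power_term (m + 2) N (Suc k) = of_nat (m + 2) / of_nat (Suc q)
        * of_nat ((j + k) choose Suc k) * of_nat ((q + j) choose j)"
      by (rule edge_power_term_eq) (simp_all add: N Suc q_def)
    have 4: "edge_power_term m (N - 1) (Suc k) = of_nat m / of_nat q
        * of_nat (Suc (j + k) choose Suc k) * b"
      unfolding b_def by (rule edge_power_term_eq) (simp_all add: N Suc q_def)
    have 5: "edge_power_term (m + 3) (N - 1) k = of_nat (m + 3) / of_nat (Suc q)
        * E * of_nat (Suc (q + j) choose Suc j)"
      unfolding E_def by (rule edge_power_term_eq) (simp_all add: N Suc q_def)
    define k1 where "k1 = (of_nat k + 1 :: rat)"
    have k1: "k1 > 0"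
      by (simp add: k1_def add_pos_nonneg)
    show ?thesis
      unfolding 1 2 3 4 5 c0 c1 d0 d1 k1_def[symmetric] using q(1) k1
      by (simp add: divide_simps) (simp add: q(2) k1_def algebra_simps)
  qed
qed (auto simp: edge_power_term_def)

lemma edge_power_coeff_eq_sum:
  assumes "0 < N \<or> 0 < m" "N \<le> K"
  shows "edge_power_coeff m N = (\<Sum>k\<le>K. edge_power_term m N k)"
proof (cases "N = 0")
  case True
  with assms have "edge_power_term m N k = 0" for k
    by (simp add: edge_power_term_def)
  with True assms show ?thesis
    by (simp add: edge_power_coeff_def)
next
  case False
  have "(\<Sum>k\<le>N. edge_power_term m N k) = (\<Sum>k\<le>K. edge_power_term m N k)"
    using assms by (intro sum.mono_neutral_left) (auto simp: edge_power_term_def)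
  with False show ?thesis
    by (simp add: edge_power_coeff_def)
qed

lemma edge_power_coeff_rec:
  assumes "0 < N"
  shows "edge_power_coeff (m + 1) N + (if 2 \<le> N then edge_power_coeff (m + 2) (N - 2) else 0) =
    edge_power_coeff (m + 2) N + edge_power_coeff m (N - 1) + edge_power_coeff (m + 3) (N - 1)"
proof (cases "2 \<le> N")
  case False
  with assms have "N = 1"
    by simp
  then show ?thesis
    by (simp add: edge_power_coeff_def edge_power_term_def)
next
  case True
  have "edge_power_coeff (m + 1) N + edge_power_coeff (m + 2) (N - 2) =
      (\<Sum>k\<le>Suc N. edge_power_term (m + 1) N k) + (\<Sum>k\<le>N. edge_power_term (m + 2) (N - 2) k)"
    using True by (intro arg_cong2[of _ _ _ _ "(+)"] edge_power_coeff_eq_sum) auto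
  also have "\<dots> = edge_power_term (m + 1) N 0 + (\<Sum>k\<le>N. edge_power_term (m + 1) N (Suc k)
      + edge_power_term (m + 2) (N - 2) k)"
    by (simp only: sum.atMost_Suc_shift sum.distrib add.assoc)
  also have "\<dots> = (\<Sum>k\<le>Suc N. edge_power_term (m + 2) N k) + (\<Sum>k\<le>Suc N. edge_power_term m (N - 1) k)
      + (\<Sum>k\<le>N. edge_power_term (m + 3) (N - 1) k)"
    unfolding edge_power_term_rec_0[OF True] edge_power_term_rec_Suc[OF True]
      sum.atMost_Suc_shift sum.distrib by (simp add: algebra_simps)
  also have "\<dots> = edge_power_coeff (m + 2) N + edge_power_coeff m (N - 1) + edge_power_coeff (m + 3) (N - 1)"
    using True by (intro arg_cong2[of _ _ _ _ "(+)"] edge_power_coeff_eq_sum[symmetric]) auto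
  finally show ?thesis
    using True by simp
qed

text \<open>
  The recurrence determines the coefficients: it expresses the one of \<open>t\<^sup>m\<^sup>+\<^sup>1\<close> in degree \<open>N\<close> through
  that of \<open>t\<^sup>m\<^sup>+\<^sup>2\<close> in the same degree and through smaller degrees, and \<open>t\<^sup>m\<close> has no term of degree
  \<open>N\<close> once \<open>m > N\<close>. So the induction runs upwards in \<open>N\<close> and, inside, downwards in \<open>m\<close>.
\<close>

lemma edge_power_nth:
  fixes t :: "rat fps"
  assumes t0: "fps_nth t 0 = 0" and t: "(t - fps_X) * (1 - fps_X * t ^ 2) = t ^ 2"
  shows "fps_nth (t ^ m) N = edge_power_coeff m N"
proof (induction N arbitrary: m rule: less_induct)
  case (less N)
  note smaller = less.IH
  show ?case
  proof (cases "N = 0")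
    case True
    then show ?thesis
      using t0 by (cases m) (simp_all add: edge_power_coeff_def)
  next
    case False
    show ?thesis
    proof (induction "Suc N - m" arbitrary: m rule: less_induct)
      case (less m)
      consider "m = 0" | "N < m" | m' where "m = m' + 1" "m' + 1 \<le> N"
        by (metis Suc_eq_plus1 not0_implies_Suc not_less)
      then show ?case
      proof cases
        case 1
        have "edge_power_term 0 N k = 0" for k
          by (simp add: edge_power_term_def)
        with False 1 show ?thesis
          by (simp add: edge_power_coeff_def)
      next
        case 2
        then have "edge_power_coeff m N = 0"
          by (simp add: edge_power_coeff_def edge_power_term_def)
        then show ?thesis
          using startsby_zero_power_prefix[OF t0] 2 by simp
      next
        case 3
        have "t ^ (m' + 1) + fps_X ^ 2 * t ^ (m' + 2) - (t ^ (m' + 2) + fps_X * t ^ m' + fps_X * t ^ (m' + 3))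
            = t ^ m' * ((t - fps_X) * (1 - fps_X * t ^ 2) - t ^ 2)"
          by (simp add: algebra_simps power_add power2_eq_square power3_eq_cube)
        then have "t ^ (m' + 1) + fps_X ^ 2 * t ^ (m' + 2) =
            t ^ (m' + 2) + fps_X * t ^ m' + fps_X * t ^ (m' + 3)"
          using t by simp
        then have "fps_nth (t ^ (m' + 1) + fps_X ^ 2 * t ^ (m' + 2)) N =
            fps_nth (t ^ (m' + 2) + fps_X * t ^ m' + fps_X * t ^ (m' + 3)) N"
          by (rule arg_cong)
        then have "fps_nth (t ^ (m' + 1)) N + (if 2 \<le> N then fps_nth (t ^ (m' + 2)) (N - 2) else 0) =
            fps_nth (t ^ (m' + 2)) N + fps_nth (t ^ m') (N - 1) + fps_nth (t ^ (m' + 3)) (N - 1)"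
          using False by (simp only: fps_add_nth fps_X_power_mult_nth fps_X_mult_nth) (auto simp: not_le)
        moreover have "fps_nth (t ^ (m' + 2)) N = edge_power_coeff (m' + 2) N"
          using 3 by (intro less) simp
        ultimately show ?thesis
          using edge_power_coeff_rec[of N m'] False
          unfolding 3(1) by (simp add: smaller del: power_Suc split: if_splits)
      qed
    qed
  qed
qed

text \<open>
  The same sum with the range and the integer binomials of \<open>P_coeff\<close> (\<open>m = 1\<close>) and \<open>W11_coeff\<close>
  (\<open>m = 3 j\<close>). A negative upper entry occurs only for \<open>N = m\<close>, \<open>k = 0\<close>, where the convention
  \<open>binom (-1) 0 = 1\<close> is the correct value.
\<close>

lemma edge_power_coeff_closed_form:
  assumes "0 < m" "m \<le> N"
  shows "edge_power_coeff m N = (\<Sum>k = 0..(N - m) div 3. of_nat m / (of_nat N - of_nat k)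
    * of_nat (binom (int N - int m - 2 * int k - 1) (int k))
    * of_nat (binom (2 * int N - int m - 4 * int k - 1) (int N - int m - 3 * int k)))"
    (is "_ = sum ?f _")
proof -
  have "edge_power_coeff m N = sum (edge_power_term m N) {..N}"
    using assms by (intro edge_power_coeff_eq_sum) auto
  also have "\<dots> = sum (edge_power_term m N) {0..(N - m) div 3}"
    using assms by (intro sum.mono_neutral_right) (auto simp: edge_power_term_def)
  also have "\<dots> = sum ?f {0..(N - m) div 3}"
  proof (rule sum.cong)
    fix k assume "k \<in> {0..(N - m) div 3}"
    then obtain i where N: "N = m + 3 * k + i"
      using assms(2) by (metis Nat.le_diff_conv2 add.commute add.left_commute atLeastAtMost_iff
          le_Suc_ex less_eq_div_iff_mult_less_eq mult.commute zero_less_numeral)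
    have 1: "binom (int N - int m - 2 * int k - 1) (int k) = (i + k - 1) choose k"
    proof (cases "i + k = 0")
      case False
      then have "int N - int m - 2 * int k - 1 = int (i + k - 1)"
        by (simp add: N of_nat_diff Suc_le_eq)
      then show ?thesis
        by (simp add: binom_def del: of_nat_diff)
    qed (simp add: N binom_def)
    have "2 * int N - int m - 4 * int k - 1 = int (m + 2 * k + i + i - 1)"
      "int N - int m - 3 * int k = int i"
      using assms by (simp_all add: N of_nat_diff)
    then have 2: "binom (2 * int N - int m - 4 * int k - 1) (int N - int m - 3 * int k) =
        (m + 2 * k + i + i - 1) choose i"
      by (simp add: binom_def del: of_nat_diff)
    have 3: "(of_nat N - of_nat k :: rat) = of_nat (m + 2 * k + i)"
      by (simp add: N)
    show "edge_power_term m N k = ?f k"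
      unfolding 1 2 3 by (rule edge_power_term_eq) (simp_all add: N)
  qed simp
  finally show ?thesis .
qed

lemma P_fps_equation: "fps_nth (fps_X * P_fps) 0 = 0"
    "(fps_X * P_fps - fps_X) * (1 - fps_X * (fps_X * P_fps) ^ 2) = (fps_X * P_fps) ^ 2"
proof -
  obtain t :: "rat fps" where t0: "fps_nth t 0 = 0"
    and t: "(t - fps_X) * (1 - fps_X * t ^ 2) = t ^ 2"
    using edge_equation_solvable by blast
  have "P_coeff n = fps_nth t (Suc n)" for n
  proof -
    have "fps_nth t (Suc n) = edge_power_coeff 1 (Suc n)"
      using edge_power_nth[OF t0 t, of 1] by simp
    also have "\<dots> = P_coeff n"
    proof (cases "n = 0")
      case True
      then show ?thesis
        by (simp add: P_coeff_def edge_power_coeff_def edge_power_term_def)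
    next
      case False
      then show ?thesis
        by (subst edge_power_coeff_closed_form)
           (auto simp: P_coeff_def algebra_simps intro!: sum.cong)
    qed
    finally show ?thesis ..
  qed
  then have "fps_X * P_fps = t"
    using t0 by (auto simp: fps_eq_iff P_fps_def gr0_conv_Suc)
  with t0 t show "fps_nth (fps_X * P_fps) 0 = 0"
    "(fps_X * P_fps - fps_X) * (1 - fps_X * (fps_X * P_fps) ^ 2) = (fps_X * P_fps) ^ 2"
    by simp_all
qed

text \<open>
  In the tree of triangles: \<open>edge_series\<close> is the series \<open>t\<close> of passages from a vertex of a triangle to
  the next one; \<open>root_series\<close> counts sequences of rounds in the starting triangle; \<open>branch_series\<close> counts
  sequences of rounds in a triangle entered through an \<open>S\<close>-edge, without use of that edge. In the
  last case the side leaving the entry vertex has no excursion and is just \<open>X\<close>.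
\<close>

definition edge_series :: "rat fps" where
  "edge_series = fps_X * P_fps"

definition root_series :: "rat fps" where
  "root_series = inverse (1 - edge_series ^ 3)"

definition branch_series :: "rat fps" where
  "branch_series = inverse (1 - fps_X * edge_series ^ 2)"

lemma edge_series_nth_0 [simp]: "fps_nth edge_series 0 = 0"
  by (simp add: edge_series_def)

lemma edge_series_power_mult_nth_eq_0:
  "N < k \<Longrightarrow> fps_nth (edge_series ^ k * f) N = 0"
  by (simp add: edge_series_def power_mult_distrib mult.assoc fps_X_power_mult_nth)

lemma root_series_eq: "root_series = 1 + edge_series ^ 3 * root_series"
proof -
  have "root_series * (1 - edge_series ^ 3) = 1"
    unfolding root_series_def by (rule inverse_mult_eq_1) (simp add: startsby_zero_power)
  then show ?thesis
    by (simp add: algebra_simps)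
qed

lemma branch_series_eq: "branch_series = 1 + fps_X * edge_series ^ 2 * branch_series"
proof -
  have "branch_series * (1 - fps_X * edge_series ^ 2) = 1"
    unfolding branch_series_def by (rule inverse_mult_eq_1) simp
  then show ?thesis
    by (simp add: algebra_simps)
qed

lemma edge_series_eq: "edge_series = fps_X + branch_series * edge_series ^ 2"
proof -
  have "branch_series * (1 - fps_X * edge_series ^ 2) = 1"
    using branch_series_eq by (simp add: algebra_simps)
  moreover have "(edge_series - fps_X) * (1 - fps_X * edge_series ^ 2) = edge_series ^ 2"
    using P_fps_equation(2) by (simp only: edge_series_def)
  ultimately have "edge_series - fps_X = branch_series * edge_series ^ 2"
    by (metis (no_types) mult.left_commute mult.right_neutral)
  then show ?thesis
    by (simp add: algebra_simps)
qed

lemma W11_fps: "Abs_fps W11_coeff = fps_X * root_series"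
proof (rule fps_ext)
  fix n
  show "fps_nth (Abs_fps W11_coeff) n = fps_nth (fps_X * root_series) n"
  proof (cases n)
    case (Suc N)
    define K where "K = Suc (N div 3)"
    have "(1 - edge_series ^ 3) * (\<Sum>j<K. (edge_series ^ 3) ^ j) = 1 - (edge_series ^ 3) ^ K"
      by (rule one_diff_power_eq[symmetric])
    moreover have "root_series * (1 - edge_series ^ 3) = 1"
      using root_series_eq by (simp add: algebra_simps)
    ultimately have "(\<Sum>j<K. (edge_series ^ 3) ^ j) = root_series * (1 - (edge_series ^ 3) ^ K)"
      by (metis (no_types) mult.assoc mult_1)
    then have "root_series = (\<Sum>j<K. edge_series ^ (3 * j)) + edge_series ^ (3 * K) * root_series"
      by (simp add: right_diff_distrib mult.commute flip: power_mult)
    then have "fps_nth root_series N = (\<Sum>j<K. fps_nth (edge_series ^ (3 * j)) N)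
        + fps_nth (edge_series ^ (3 * K) * root_series) N"
      by (metis fps_add_nth fps_sum_nth)
    also have "fps_nth (edge_series ^ (3 * K) * root_series) N = 0"
      by (rule edge_series_power_mult_nth_eq_0) (simp add: K_def)
    also have "(\<Sum>j<K. fps_nth (edge_series ^ (3 * j)) N) = (\<Sum>j<K. edge_power_coeff (3 * j) N)"
      using edge_power_nth[OF edge_series_nth_0] P_fps_equation(2) by (simp add: edge_series_def)
    also have "\<dots> = of_bool (N = 0) + (\<Sum>j = 1..N div 3. edge_power_coeff (3 * j) N)"
    proof -
      have "edge_power_coeff 0 N = of_bool (N = 0)"
        using edge_power_nth[OF edge_series_nth_0, of 0 N] P_fps_equation(2)
        by (cases "N = 0") (simp_all add: edge_series_def)
      then show ?thesis
        by (simp only: K_def sum.lessThan_Suc_shift sum.atLeast1_atMost_eq One_nat_def) simp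
    qed
    also have "\<dots> + 0 = W11_coeff n"
    proof (cases "N = 0")
      case False
      define inner where "inner j = (\<Sum>k = 0..(n - 3 * j - 1) div 3.
          (3 * of_nat j :: rat) / (of_nat n - 1 - of_nat k)
          * of_nat (binom (int n - 3 * int j - 2 * int k - 2) (int k))
          * of_nat (binom (2 * int n - 3 * int j - 4 * int k - 3) (int n - 3 * int j - 3 * int k - 1)))"
        for j
      have "edge_power_coeff (3 * j) N = inner j" if "j \<in> {1..N div 3}" for j
        using that unfolding inner_def by (subst edge_power_coeff_closed_form)
          (auto simp: Suc algebra_simps intro!: sum.cong)
      then have "(\<Sum>j = 1..N div 3. edge_power_coeff (3 * j) N) = (\<Sum>j = 1..N div 3. inner j)"
        by (intro sum.cong) auto
      also have "\<dots> = W11_coeff n"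
        unfolding W11_coeff_def inner_def using False by (simp add: Suc)
      finally show ?thesis
        using False by simp
    qed (simp add: Suc W11_coeff_def)
    finally show ?thesis
      by (simp add: Suc)
  qed (simp add: W11_coeff_def)
qed

section \<open>Removing the first or the last entry\<close>

abbreviation nsol :: "int^2^2 \<Rightarrow> nat \<Rightarrow> nat" where
  "nsol M n \<equiv> card (solutions M n)"

text \<open>
  With \<open>U = T S\<close>, these are the inverses of \<open>U\<close>, of \<open>- S U\<close> and of \<open>T\<close>. Right multiplication by the first
  two removes the last letter of a word in \<open>U\<close> and \<open>S U\<close>, for \<open>T\<^sup>a S = (T\<^sup>a\<^sup>-\<^sup>1 S) (- S U)\<close>.
\<close>

definition U_inv :: "int^2^2" where "U_inv = mat2 0 1 (-1) 1"
definition SU_inv :: "int^2^2" where "SU_inv = mat2 1 0 1 1"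
definition T_inv :: "int^2^2" where "T_inv = mat2 1 (-1) 0 1"

lemma matrix_mult_minus [simp]:
  "(- X) ** Y = - (X ** Y)" "X ** (- Y) = - (X ** Y)" for X Y :: "int^2^2"
  by (rule mat2_eqI; simp)+

lemma solutions_minus [simp]: "solutions (- M) n = solutions M n"
  by (auto simp: solutions_def)

lemma matrix_mult_right_cancel:
  fixes A B M X :: "int^2^2"
  assumes "A ** B = mat 1" "B ** A = mat 1"
  shows "X ** A = M \<longleftrightarrow> X = M ** B"
  using assms by (metis matrix_mul_assoc matrix_mul_rid)

lemma matrix_mult_left_cancel:
  fixes A B M X :: "int^2^2"
  assumes "A ** B = mat 1" "B ** A = mat 1"
  shows "A ** X = M \<longleftrightarrow> X = B ** M"
  using assms by (metis matrix_mul_assoc matrix_mul_lid)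

lemma M_prod_Cons_eq_iff:
  "M_prod (a # as) = M \<longleftrightarrow> M_prod as = M ** mat2 0 1 (-1) a"
proof -
  have "mat2 a (-1) 1 0 ** mat2 0 1 (-1) a = mat 1" "mat2 0 1 (-1) a ** mat2 a (-1) 1 0 = mat 1"
    by (rule mat2_eqI; simp)+
  from matrix_mult_right_cancel[OF this] show ?thesis
    by simp
qed

lemma M_prod_snoc_eq_iff:
  "M_prod (as @ [a]) = M \<longleftrightarrow> M_prod as = mat2 0 1 (-1) a ** M"
proof -
  have "mat2 a (-1) 1 0 ** mat2 0 1 (-1) a = mat 1" "mat2 0 1 (-1) a ** mat2 a (-1) 1 0 = mat 1"
    by (rule mat2_eqI; simp)+
  from matrix_mult_left_cancel[OF this] show ?thesis
    by (simp add: M_prod_append)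
qed

lemma Cons_in_solutions_iff:
  "a # as \<in> solutions M (Suc n) \<longleftrightarrow> 0 < a \<and> as \<in> solutions (M ** mat2 0 1 (-1) a) n"
  using M_prod_Cons_eq_iff[of a as M] M_prod_Cons_eq_iff[of a as "- M"]
  by (auto simp: solutions_def simp del: M_prod.simps)

lemma snoc_in_solutions_iff:
  "as @ [a] \<in> solutions M (Suc n) \<longleftrightarrow> 0 < a \<and> as \<in> solutions (mat2 0 1 (-1) a ** M) n"
  using M_prod_snoc_eq_iff[of as a M] M_prod_snoc_eq_iff[of as a "- M"]
  by (auto simp: solutions_def simp del: M_prod.simps)

lemma length_solutions: "as \<in> solutions M n \<Longrightarrow> length as = n"
  by (simp add: solutions_def)

lemma nsol_hd: "card {as \<in> solutions M (Suc n). hd as = int a} = nsol (M ** mat2 0 1 (-1) (int a)) n"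
  if "0 < a"
proof -
  have "{as \<in> solutions M (Suc n). hd as = int a} =
      (\<lambda>as. int a # as) ` solutions (M ** mat2 0 1 (-1) (int a)) n"
  proof (intro set_eqI iffI)
    fix as assume as: "as \<in> {as \<in> solutions M (Suc n). hd as = int a}"
    then have "length as = Suc n"
      by (auto dest: length_solutions)
    with as show "as \<in> (\<lambda>as. int a # as) ` solutions (M ** mat2 0 1 (-1) (int a)) n"
      by (cases as) (auto simp: Cons_in_solutions_iff)
  qed (use that in \<open>auto simp: Cons_in_solutions_iff\<close>)
  then show ?thesis
    by (simp add: card_image inj_on_def)
qed

lemma nsol_last: "card {as \<in> solutions M (Suc n). last as = int a} = nsol (mat2 0 1 (-1) (int a) ** M) n"
  if "0 < a"
proof -
  have "{as \<in> solutions M (Suc n). last as = int a} =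
      (\<lambda>as. as @ [int a]) ` solutions (mat2 0 1 (-1) (int a) ** M) n"
  proof (intro set_eqI iffI)
    fix as assume as: "as \<in> {as \<in> solutions M (Suc n). last as = int a}"
    then have "length as = Suc n"
      by (auto dest: length_solutions)
    with as show "as \<in> (\<lambda>as. as @ [int a]) ` solutions (mat2 0 1 (-1) (int a) ** M) n"
      by (cases as rule: rev_cases) (auto simp: snoc_in_solutions_iff)
  qed (use that in \<open>auto simp: snoc_in_solutions_iff\<close>)
  then show ?thesis
    by (simp add: card_image inj_on_def)
qed

lemma SU_inv_mult: "SU_inv ** mat2 0 1 (-1) a = mat2 0 1 (-1) (a + 1)"
  by (rule mat2_eqI) (simp_all add: SU_inv_def)

lemma T_inv_mult: "mat2 0 1 (-1) a ** T_inv = mat2 0 1 (-1) (a + 1)"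
  by (rule mat2_eqI) (simp_all add: T_inv_def)

lemma nsol_hd_greater:
  "card {as \<in> solutions M (Suc n). 1 < hd as} = nsol (M ** SU_inv) (Suc n)"
proof -
  have shift: "a # as \<in> solutions (M ** SU_inv) (Suc n) \<longleftrightarrow> 0 < a \<and> (a + 1) # as \<in> solutions M (Suc n)"
    for a as
    by (auto simp: Cons_in_solutions_iff SU_inv_mult simp flip: matrix_mul_assoc)
  let ?inc = "\<lambda>as. (hd as + 1) # tl as"
  have "{as \<in> solutions M (Suc n). 1 < hd as} = ?inc ` solutions (M ** SU_inv) (Suc n)"
  proof (intro set_eqI iffI)
    fix as assume as: "as \<in> {as \<in> solutions M (Suc n). 1 < hd as}"
    then obtain a bs where "as = a # bs"
      by (cases as) (auto simp: solutions_def)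
    with as have "(a - 1) # bs \<in> solutions (M ** SU_inv) (Suc n)" "as = ?inc ((a - 1) # bs)"
      by (auto simp: shift)
    then show "as \<in> ?inc ` solutions (M ** SU_inv) (Suc n)"
      by (rule rev_image_eqI)
  next
    fix as assume "as \<in> ?inc ` solutions (M ** SU_inv) (Suc n)"
    then obtain bs where bs: "bs \<in> solutions (M ** SU_inv) (Suc n)" "as = ?inc bs"
      by blast
    then show "as \<in> {as \<in> solutions M (Suc n). 1 < hd as}"
      by (cases bs) (auto simp: shift dest: length_solutions)
  qed
  moreover have "inj_on ?inc (solutions (M ** SU_inv) (Suc n))"
  proof (rule inj_onI)
    fix as bs assume "as \<in> solutions (M ** SU_inv) (Suc n)" "bs \<in> solutions (M ** SU_inv) (Suc n)"
      "?inc as = ?inc bs"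
    then show "as = bs"
      by (cases as; cases bs) (auto dest: length_solutions)
  qed
  ultimately show ?thesis
    by (simp add: card_image)
qed

lemma nsol_last_greater:
  "card {as \<in> solutions M (Suc n). 1 < last as} = nsol (T_inv ** M) (Suc n)"
proof -
  have shift: "as @ [a] \<in> solutions (T_inv ** M) (Suc n) \<longleftrightarrow> 0 < a \<and> as @ [a + 1] \<in> solutions M (Suc n)"
    for a as
    by (auto simp: snoc_in_solutions_iff T_inv_mult matrix_mul_assoc)
  let ?inc = "\<lambda>as. butlast as @ [last as + 1]"
  have "{as \<in> solutions M (Suc n). 1 < last as} = ?inc ` solutions (T_inv ** M) (Suc n)"
  proof (intro set_eqI iffI)
    fix as assume as: "as \<in> {as \<in> solutions M (Suc n). 1 < last as}"
    then obtain a bs where "as = bs @ [a]"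
      by (cases as rule: rev_cases) (auto simp: solutions_def)
    with as have "bs @ [a - 1] \<in> solutions (T_inv ** M) (Suc n)" "as = ?inc (bs @ [a - 1])"
      by (auto simp: shift)
    then show "as \<in> ?inc ` solutions (T_inv ** M) (Suc n)"
      by (rule rev_image_eqI)
  next
    fix as assume "as \<in> ?inc ` solutions (T_inv ** M) (Suc n)"
    then obtain bs where bs: "bs \<in> solutions (T_inv ** M) (Suc n)" "as = ?inc bs"
      by blast
    then show "as \<in> {as \<in> solutions M (Suc n). 1 < last as}"
      by (cases bs rule: rev_cases) (auto simp: shift dest: length_solutions)
  qed
  moreover have "inj_on ?inc (solutions (T_inv ** M) (Suc n))"
  proof (rule inj_onI)
    fix as bs assume "as \<in> solutions (T_inv ** M) (Suc n)" "bs \<in> solutions (T_inv ** M) (Suc n)"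
      "?inc as = ?inc bs"
    then show "as = bs"
      by (cases as rule: rev_cases; cases bs rule: rev_cases) (auto dest: length_solutions)
  qed
  ultimately show ?thesis
    by (simp add: card_image)
qed

lemma nsol_split_hd: "nsol M (Suc n) = nsol (M ** U_inv) n + nsol (M ** SU_inv) (Suc n)"
proof -
  have "1 \<le> hd as" if "as \<in> solutions M (Suc n)" for as
    using that by (cases as) (auto simp: solutions_def)
  then have "solutions M (Suc n) =
      {as \<in> solutions M (Suc n). hd as = int 1} \<union> {as \<in> solutions M (Suc n). 1 < hd as}"
    by force
  then have "nsol M (Suc n) = card {as \<in> solutions M (Suc n). hd as = int 1}
      + card {as \<in> solutions M (Suc n). 1 < hd as}"
    by (metis (mono_tags, lifting) card_Un_disjoint finite_solutions disjoint_iff finite_Un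
        mem_Collect_eq of_nat_1 less_irrefl)
  then show ?thesis
    unfolding nsol_hd_greater using nsol_hd[of 1 M n] by (simp add: U_inv_def)
qed

lemma nsol_split_last: "nsol M (Suc n) = nsol (U_inv ** M) n + nsol (T_inv ** M) (Suc n)"
proof -
  have "1 \<le> last as" if "as \<in> solutions M (Suc n)" for as
    using that by (cases as rule: rev_cases) (auto simp: solutions_def)
  then have "solutions M (Suc n) =
      {as \<in> solutions M (Suc n). last as = int 1} \<union> {as \<in> solutions M (Suc n). 1 < last as}"
    by force
  then have "nsol M (Suc n) = card {as \<in> solutions M (Suc n). last as = int 1}
      + card {as \<in> solutions M (Suc n). 1 < last as}"
    by (metis (mono_tags, lifting) card_Un_disjoint finite_solutions disjoint_iff finite_Un
        mem_Collect_eq of_nat_1 less_irrefl)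
  then show ?thesis
    unfolding nsol_last_greater using nsol_last[of 1 M n] by (simp add: U_inv_def)
qed

text \<open>
  The matrix \<open>mat2 1 0 j 1\<close> is the \<open>j\<close>-th power of \<open>SU_inv\<close>. A solution for the product is a solution for
  \<open>M\<close> whose first entry has been lowered by \<open>j\<close>, and the entries of the finitely many solutions for \<open>M\<close>
  are bounded.
\<close>

lemma nsol_SU_inv_pow_eventually_0:
  "\<exists>J. \<forall>j\<ge>J. nsol (M ** mat2 1 0 (int j) 1) (Suc n) = 0"
proof -
  let ?h = "\<lambda>j. {as \<in> solutions M (Suc n). int j < hd as}"
  have inj: "as \<in> solutions (M ** mat2 1 0 (int j) 1) (Suc n) \<Longrightarrow>
    (hd as + int j) # tl as \<in> solutions M (Suc n) \<and> 0 < hd as" for as j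
  proof (cases as)
    case (Cons a bs)
    have "mat2 1 0 (int j) 1 ** mat2 0 1 (-1) a = mat2 0 1 (-1) (a + int j)"
      by (rule mat2_eqI) simp_all
    moreover assume "as \<in> solutions (M ** mat2 1 0 (int j) 1) (Suc n)"
    ultimately show ?thesis
      by (auto simp: Cons Cons_in_solutions_iff simp flip: matrix_mul_assoc)
  qed (auto simp: solutions_def)
  define J where "J = nat (Max (insert 0 (hd ` solutions M (Suc n))))"
  have bound: "hd as \<le> int J" if "as \<in> solutions M (Suc n)" for as
  proof -
    have "hd as \<le> Max (insert 0 (hd ` solutions M (Suc n)))"
      using that by (intro Max_ge) (auto simp: finite_solutions)
    also have "\<dots> \<le> int J"
      by (simp add: J_def)
    finally show ?thesis .
  qed
  have "solutions (M ** mat2 1 0 (int j) 1) (Suc n) = {}" if "J \<le> j" for j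
    using inj[of _ j] bound that by force
  then show ?thesis
    by (intro exI[of _ J]) simp
qed

section \<open>Counting solutions along reduced words\<close>

text \<open>
  The list of positions \<open>[p, q, \<dots>]\<close>, most recent first, encodes the reduced word
  \<open>\<dots> S U\<^sup>q\<^sup>+\<^sup>1 S U\<^sup>p\<^sup>+\<^sup>1\<close>: position \<open>p\<close> in a triangle is reached by \<open>p + 1\<close> steps from
  the vertex where the triangle is entered, so position 2 is that vertex itself and \<open>[2]\<close> encodes the
  identity. Representatives are chosen up to sign. In a valid list only the most recent and the initial
  position may be 2: elsewhere the walk would go back through the edge by which it came, and \<open>S S = - 1\<close>
  would cancel.
\<close>

definition rot :: "nat \<Rightarrow> int^2^2" where
  "rot p = (if p = 0 then mat2 1 (-1) 1 0 else if p = 1 then mat2 0 (-1) 1 (-1) else mat 1)"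

fun stack_mat :: "nat list \<Rightarrow> int^2^2" where
  "stack_mat [] = mat 1"
| "stack_mat [p] = rot p"
| "stack_mat (p # q # s) = stack_mat (q # s) ** S_mat ** rot p"

fun valid_stack :: "nat list \<Rightarrow> bool" where
  "valid_stack [] = False"
| "valid_stack [p] = (p \<le> 2)"
| "valid_stack (p # q # s) = (p \<le> 2 \<and> (q < 2 \<or> s = []) \<and> valid_stack (q # s))"

fun weight :: "nat list \<Rightarrow> rat fps" where
  "weight [] = 0"
| "weight [p] = fps_X * edge_series ^ p * root_series"
| "weight (p # q # s) = branch_series * edge_series ^ p * weight (q # s)"

text \<open>
  The effect on positions of removing a letter \<open>U\<close> or \<open>S U\<close>, that is, of right multiplication by
  \<open>U_inv\<close> or \<open>SU_inv\<close>. After undoing \<open>U\<close>, the letter \<open>S\<close> leads into a new triangle, or out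
  of the current one if the walk stands at its entry vertex and the triangle is not the initial one.
\<close>

fun undo_U :: "nat list \<Rightarrow> nat list" where
  "undo_U (0 # s) = 2 # s"
| "undo_U (Suc p # s) = p # s"
| "undo_U [] = []"

fun undo_SU :: "nat list \<Rightarrow> nat list" where
  "undo_SU [0] = [2, 2]"
| "undo_SU (0 # q # s) = q # s"
| "undo_SU (Suc p # s) = 2 # p # s"
| "undo_SU [] = []"

lemma undo_2 [simp]: "undo_U (2 # s) = 1 # s" "undo_SU (2 # s) = 2 # 1 # s"
  by (simp_all add: numeral_2_eq_2)

lemma valid_undo_U: "valid_stack s \<Longrightarrow> valid_stack (undo_U s)"
  by (cases s rule: undo_U.cases; cases "tl s") auto

lemma valid_undo_SU: "valid_stack s \<Longrightarrow> valid_stack (undo_SU s)"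
proof (induction s rule: undo_SU.induct)
  case (3 p s)
  then show ?case
    by (cases s) auto
qed auto

definition eq_pm :: "int^2^2 \<Rightarrow> int^2^2 \<Rightarrow> bool" where
  "eq_pm M N \<longleftrightarrow> M = N \<or> M = - N"

lemma eq_pm_solutions: "eq_pm M N \<Longrightarrow> solutions M n = solutions N n"
  by (auto simp: eq_pm_def)

lemma eq_pm_mult: "eq_pm M N \<Longrightarrow> eq_pm (M ** X) (N ** X)"
  by (auto simp: eq_pm_def)

lemma eq_pm_mult_left: "eq_pm M N \<Longrightarrow> eq_pm (X ** M) (X ** N)"
  by (auto simp: eq_pm_def)

lemma eq_pm_trans: "eq_pm M N \<Longrightarrow> eq_pm N R \<Longrightarrow> eq_pm M R"
  by (auto simp: eq_pm_def)

lemma eq_pm_undo_U: "valid_stack s \<Longrightarrow> eq_pm (stack_mat (undo_U s)) (stack_mat s ** U_inv)"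
proof -
  have rot: "eq_pm (rot 2) (rot 0 ** U_inv)" "p < 2 \<Longrightarrow> eq_pm (rot p) (rot (Suc p) ** U_inv)" for p
  proof -
    have "rot 2 = rot 0 ** U_inv" "rot 0 = rot 1 ** U_inv" "rot 1 = - (rot 2 ** U_inv)"
      by (rule mat2_eqI; simp add: rot_def U_inv_def)+
    then show "eq_pm (rot 2) (rot 0 ** U_inv)" "p < 2 \<Longrightarrow> eq_pm (rot p) (rot (Suc p) ** U_inv)"
      unfolding eq_pm_def by (metis, metis One_nat_def Suc_1 less_2_cases)
  qed
  assume "valid_stack s"
  then show ?thesis
  proof (cases s rule: stack_mat.cases)
    case (2 p)
    then show ?thesis
      using rot \<open>valid_stack s\<close> by (cases p) auto
  next
    case (3 p q s')
    then show ?thesis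
      using eq_pm_mult_left[OF rot(1), of "stack_mat (q # s') ** S_mat"]
        eq_pm_mult_left[OF rot(2), of "p - 1" "stack_mat (q # s') ** S_mat"] \<open>valid_stack s\<close>
      by (cases p) (simp_all add: matrix_mul_assoc)
  qed simp
qed

lemma U_inv_S: "U_inv ** S_mat = SU_inv"
  by (rule mat2_eqI) (simp_all add: U_inv_def S_mat_def SU_inv_def)

lemma eq_pm_undo_SU:
  assumes "valid_stack s"
  shows "eq_pm (stack_mat (undo_SU s)) (stack_mat s ** SU_inv)"
proof -
  have push: "eq_pm (stack_mat (2 # undo_U s)) (stack_mat s ** SU_inv)"
  proof -
    have "undo_U s \<noteq> []"
      using assms valid_undo_U by force
    then have "stack_mat (2 # undo_U s) = stack_mat (undo_U s) ** S_mat"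
      by (cases "undo_U s") (auto simp: rot_def)
    moreover have "eq_pm (stack_mat (undo_U s) ** S_mat) (stack_mat s ** U_inv ** S_mat)"
      by (intro eq_pm_mult eq_pm_undo_U assms)
    ultimately show ?thesis
      by (simp add: U_inv_S flip: matrix_mul_assoc)
  qed
  show ?thesis
  proof (cases s rule: undo_SU.cases)
    case (2 q s')
    have "S_mat ** S_mat = - mat 1"
      by (rule mat2_eqI) (simp_all add: S_mat_def)
    then have "stack_mat (2 # 2 # q # s') = - stack_mat (q # s')"
      by (simp add: rot_def flip: matrix_mul_assoc)
    then have "eq_pm (stack_mat (q # s')) (stack_mat (2 # undo_U s))"
      by (simp add: 2 eq_pm_def)
    from eq_pm_trans[OF this push] show ?thesis
      by (simp add: 2)
  qed (use push assms in auto)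
qed

text \<open>
  This is the recurrence of \<open>nsol_split_hd\<close>, where the summand for \<open>[2]\<close> accounts for the empty tuple. The cases
  are the defining equations of the three series: \<open>root_series\<close> at the first position of the initial triangle,
  \<open>branch_series\<close> at the first position of any other one, and \<open>edge_series\<close> at later positions.
\<close>

lemma weight_rec:
  assumes "valid_stack s"
  shows "weight s = fps_X * (of_bool (undo_U s = [2]) + weight (undo_U s)) + weight (undo_SU s)"
proof (cases s rule: undo_SU.cases)
  case 1
  have "weight s = fps_X * (1 + edge_series ^ 3 * root_series)"
    using root_series_eq 1 by simp
  also have "\<dots> = fps_X * (1 + edge_series ^ 2 * (fps_X + branch_series * edge_series ^ 2) * root_series)"
    using edge_series_eq by (simp add: power3_eq_cube power2_eq_square)
  finally show ?thesis
    by (simp add: 1 algebra_simps power2_eq_square)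
next
  case (2 q s')
  have "weight s = (1 + fps_X * edge_series ^ 2 * branch_series) * weight (q # s')"
    using branch_series_eq 2 by simp
  then show ?thesis
    by (simp add: 2 algebra_simps)
next
  case (3 p s')
  have "undo_U s \<noteq> [2]"
    using assms 3 by (cases s') auto
  have step: "edge_series * x = (fps_X + branch_series * edge_series ^ 2) * x" for x
    using edge_series_eq by simp
  show ?thesis
  proof (cases s')
    case Nil
    have "weight s = edge_series * (fps_X * edge_series ^ p * root_series)"
      by (simp add: 3 Nil algebra_simps)
    then show ?thesis
      unfolding step using \<open>undo_U s \<noteq> [2]\<close> by (simp add: 3 Nil algebra_simps)
  next
    case (Cons q s'')
    have "weight s = edge_series * (branch_series * edge_series ^ p * weight (q # s''))"
      by (simp add: 3 Cons algebra_simps)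
    then show ?thesis
      unfolding step using \<open>undo_U s \<noteq> [2]\<close> by (simp add: 3 Cons algebra_simps)
  qed
qed (use assms in simp)

text \<open>
  Ping-pong: up to sign, \<open>U S\<close> and \<open>U\<^sup>2 S\<close> are the elementary matrices with entry 1 above and below the
  diagonal, so the part of a reduced word between its ends is a product of nonnegative matrices.
\<close>

lemma stack_mat_nonneg:
  assumes "valid_stack (q # s)" "q < 2 \<or> s = []"
  obtains b Z where "b \<le> 2" "\<forall>i j. 0 \<le> Z $ i $ j"
    "eq_pm (stack_mat (q # s) ** S_mat) (rot b ** S_mat ** Z)"
proof -
  have "\<exists>b Z. b \<le> 2 \<and> (\<forall>i j. 0 \<le> Z $ i $ j) \<and>
      eq_pm (stack_mat (q # s) ** S_mat) (rot b ** S_mat ** Z)"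
    using assms
  proof (induction s arbitrary: q)
    case Nil
    have "0 \<le> (mat 1 :: int^2^2) $ i $ j" for i j
      by (simp add: mat_def)
    moreover have "eq_pm (stack_mat [q] ** S_mat) (rot q ** S_mat ** mat 1)"
      by (simp add: eq_pm_def)
    ultimately show ?case
      using Nil by (intro exI[of _ q] exI[of _ "mat 1"]) simp
  next
    case (Cons r s)
    then have "valid_stack (r # s)" "r < 2 \<or> s = []"
      by auto
    then obtain b Z where b: "b \<le> 2" and Z: "\<forall>i j. 0 \<le> Z $ i $ j"
      and eq: "eq_pm (stack_mat (r # s) ** S_mat) (rot b ** S_mat ** Z)"
      using Cons.IH by blast
    define E :: "int^2^2" where "E = (if q = 0 then mat2 1 1 0 1 else mat2 1 0 1 1)"
    have E: "0 \<le> E $ i $ j" for i j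
      using exhaust_2[of i] exhaust_2[of j] by (auto simp: E_def)
    have "rot q ** S_mat = - E"
      using Cons.prems by (intro mat2_eqI) (auto simp: rot_def S_mat_def E_def)
    then have "stack_mat (q # r # s) ** S_mat = - (stack_mat (r # s) ** S_mat ** E)"
      by (simp flip: matrix_mul_assoc)
    moreover have "eq_pm (stack_mat (r # s) ** S_mat ** E) (rot b ** S_mat ** (Z ** E))"
      using eq_pm_mult[OF eq, of E] by (simp add: matrix_mul_assoc)
    ultimately have "eq_pm (stack_mat (q # r # s) ** S_mat) (rot b ** S_mat ** (Z ** E))"
      by (auto simp: eq_pm_def)
    moreover have "0 \<le> (Z ** E) $ i $ j" for i j
      using Z E by simp
    ultimately show ?case
      using b by blast
  qed
  then show thesis
    using that by blast
qed

text \<open>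
  A reduced word with an \<open>S\<close> is not 1 or -1: otherwise \<open>S Z\<close> would be a power of \<open>U\<close> up to sign for a nonnegative
  \<open>Z\<close>. But the first row of \<open>S Z\<close> is nonpositive and the second nonnegative, which is not the case
  for any power of \<open>U\<close> or its negative. This is where the freeness of the
  product of the groups generated by \<open>S\<close> and \<open>U\<close> enters, as the base case of the count.
\<close>

lemma stack_mat_nontrivial:
  assumes "valid_stack s" "eq_pm (stack_mat s) (mat 1)"
  shows "s = [2]"
proof (cases s rule: stack_mat.cases)
  case (2 p)
  moreover have "p \<noteq> 0" "p \<noteq> 1"
    by (rule notI; use assms(2) in \<open>simp add: 2 eq_pm_def rot_def vec_eq_iff forall_2\<close>)+
  ultimately show ?thesis
    using assms(1) by simp
next
  case (3 p q s')
  then have "valid_stack (q # s')" "q < 2 \<or> s' = []"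
    using assms(1) by auto
  then obtain b Z where b: "b \<le> 2" and Z: "\<forall>i j. 0 \<le> Z $ i $ j"
    and eq: "eq_pm (stack_mat (q # s') ** S_mat) (rot b ** S_mat ** Z)"
    by (rule stack_mat_nonneg)
  have p: "p \<le> 2"
    using 3 assms(1) by simp
  have "eq_pm (mat 1) (stack_mat s)"
    using assms(2) by (auto simp: eq_pm_def)
  moreover have "eq_pm (stack_mat s) (rot b ** S_mat ** Z ** rot p)"
    using eq_pm_mult[OF eq] by (simp add: 3)
  ultimately have "eq_pm (mat 1) (rot b ** S_mat ** Z ** rot p)"
    by (rule eq_pm_trans)
  then have one: "rot b ** S_mat ** Z ** rot p = mat 1 \<or> rot b ** S_mat ** Z ** rot p = - mat 1"
    by (auto simp: eq_pm_def)
  have Z': "0 \<le> Z $ 1 $ 1" "0 \<le> Z $ 1 $ 2" "0 \<le> Z $ 2 $ 1" "0 \<le> Z $ 2 $ 2"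
    using Z by blast+
  have "b = 0 \<or> b = 1 \<or> b = 2" "p = 0 \<or> p = 1 \<or> p = 2"
    using b p by auto
  then have False
    using one Z' by (elim disjE) (simp_all add: rot_def S_mat_def vec_eq_iff forall_2)
  then show ?thesis ..
qed (use assms in simp)

lemma weight_nth_0: "fps_nth (weight s) 0 = 0"
  by (induction s rule: weight.induct) auto

lemma nsol_0: "valid_stack s \<Longrightarrow> nsol (stack_mat s) 0 = of_bool (s = [2])"
proof -
  assume "valid_stack s"
  have "solutions M 0 = (if eq_pm M (mat 1) then {[]} else {})" for M
    by (auto simp: solutions_def eq_pm_def)
  moreover have "eq_pm (stack_mat [2]) (mat 1)"
    by (simp add: eq_pm_def rot_def)
  ultimately show ?thesis
    using stack_mat_nontrivial[OF \<open>valid_stack s\<close>] by auto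
qed

text \<open>
  Induction on \<open>n\<close>. Both sides satisfy the same recurrence, whose part with fewer entries
  agrees by induction, so the error is unchanged by \<open>undo_SU\<close>. Repeated application of \<open>undo_SU\<close> first
  leaves the current triangle as long as the position is 0, and then goes into new triangles
  forever. On that ray the weight gains a factor \<open>t\<close> at every step, so its coefficient vanishes
  eventually, and so does the number of solutions by \<open>nsol_SU_inv_pow_eventually_0\<close>. Hence the error is 0.
\<close>

lemma nsol_stack:
  assumes "valid_stack s"
  shows "of_nat (nsol (stack_mat s) n) = fps_nth (of_bool (s = [2]) + weight s) n"
  using assms
proof (induction n arbitrary: s)
  case 0
  then show ?case
    by (simp add: nsol_0 weight_nth_0)
next
  case (Suc n)
  define err where "err s = of_nat (nsol (stack_mat s) (Suc n)) - fps_nth (weight s) (Suc n)" for s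
  have err_undo: "err s = err (undo_SU s)" if "valid_stack s" for s
  proof -
    have "nsol (stack_mat s) (Suc n) =
        nsol (stack_mat (undo_U s)) n + nsol (stack_mat (undo_SU s)) (Suc n)"
      unfolding nsol_split_hd[of "stack_mat s"]
      using eq_pm_solutions[OF eq_pm_undo_U[OF that]] eq_pm_solutions[OF eq_pm_undo_SU[OF that]]
      by simp
    moreover have "fps_nth (weight s) (Suc n) =
        fps_nth (of_bool (undo_U s = [2]) + weight (undo_U s)) n + fps_nth (weight (undo_SU s)) (Suc n)"
      by (subst weight_rec[OF that]) simp
    ultimately show ?thesis
      using Suc.IH[OF valid_undo_U[OF that]] by (simp add: err_def)
  qed
  have err_2: "err (2 # s) = 0" if "valid_stack (2 # s)" for s
  proof -
    define r where "r j = 2 # replicate j 1 @ s" for j :: nat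
    have r_Suc: "undo_SU (r j) = r (Suc j)" for j
      by (simp add: r_def)
    have valid: "valid_stack (r j)" for j
    proof (induction j)
      case (Suc j)
      from valid_undo_SU[OF this] show ?case
        by (simp add: r_Suc)
    qed (use that in \<open>simp add: r_def\<close>)
    have mat: "eq_pm (stack_mat (r j)) (stack_mat (2 # s) ** mat2 1 0 (int j) 1)" for j
    proof (induction j)
      case 0
      have "mat2 1 0 0 1 = mat 1"
        by (rule mat2_eqI) simp_all
      then show ?case
        by (simp add: r_def eq_pm_def)
    next
      case (Suc j)
      have "mat2 1 0 (int j) 1 ** SU_inv = mat2 1 0 (int (Suc j)) 1"
        by (rule mat2_eqI) (simp_all add: SU_inv_def)
      then show ?case
        using eq_pm_trans[OF eq_pm_undo_SU[OF valid] eq_pm_mult[OF Suc]]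
        by (simp add: r_Suc flip: matrix_mul_assoc)
    qed
    have weight: "weight (r j) = (branch_series * edge_series) ^ j * weight (r 0)" for j
    proof (induction j)
      case (Suc j)
      have "weight (r (Suc j)) = branch_series * edge_series * weight (r j)"
        by (cases "replicate j 1 @ s") (simp_all add: r_def power2_eq_square mult_ac)
      with Suc show ?case
        by (simp add: mult_ac)
    qed simp
    obtain J where J: "\<And>j. J \<le> j \<Longrightarrow> nsol (stack_mat (2 # s) ** mat2 1 0 (int j) 1) (Suc n) = 0"
      using nsol_SU_inv_pow_eventually_0 by blast
    define j where "j = max J (Suc (Suc n))"
    have "fps_nth (weight (r j)) (Suc n) = 0"
      unfolding weight[of j] power_mult_distrib
      using edge_series_power_mult_nth_eq_0[of "Suc n" j "branch_series ^ j * weight (r 0)"]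
      by (simp add: j_def mult.assoc mult.left_commute)
    moreover have "nsol (stack_mat (r j)) (Suc n) = 0"
      using J[of j] eq_pm_solutions[OF mat[of j]] by (simp add: j_def)
    ultimately have "err (r j) = 0"
      by (simp add: err_def)
    moreover have "err (r j) = err (r 0)" for j
    proof (induction j)
      case (Suc j)
      then show ?case
        using err_undo[OF valid[of j]] by (metis r_Suc)
    qed simp
    ultimately show ?thesis
      by (simp add: r_def)
  qed
  have err_1: "err (1 # s) = 0" if "valid_stack (1 # s)" for s
    using err_undo[OF that] err_2[of "0 # s"] valid_undo_SU[OF that] by simp
  have "err s = 0"
    using Suc.prems
  proof (induction s)
    case (Cons p s)
    from Cons.prems have "p \<le> 2"
      by (cases s) auto
    then consider "p = 0" | "p = 1" | "p = 2"
      by linarith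
    then show ?case
    proof cases
      case 1
      show ?thesis
      proof (cases s)
        case Nil
        with 1 show ?thesis
          using err_undo[of "[0]"] err_2[of "[2]"] by simp
      next
        case (Cons q s')
        with 1 Cons.prems Cons.IH show ?thesis
          using err_undo[of "0 # q # s'"] by simp
      qed
    qed (use err_1 err_2 Cons.prems in blast)+
  qed simp
  then show ?case
    by (simp add: err_def)
qed

section \<open>The numbers V and W\<close>

lemma nsol_U: "of_nat (nsol (mat2 1 (-1) 1 0) n) = fps_nth (fps_X * root_series) n"
  using nsol_stack[of "[0]" n] by (simp add: rot_def)

lemma nsol_U_inv: "of_nat (nsol U_inv n) = fps_nth (fps_X * edge_series * root_series) n"
proof -
  have "eq_pm (stack_mat [1]) U_inv"
    unfolding eq_pm_def by (intro disjI2 mat2_eqI) (simp_all add: rot_def U_inv_def)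
  from eq_pm_solutions[OF this] show ?thesis
    using nsol_stack[of "[1]" n] by simp
qed

lemma W11_eq_nsol: "W11_coeff n = of_nat (nsol (mat2 1 (-1) 1 0) n)"
  using W11_fps by (simp add: nsol_U fps_eq_iff)

text \<open>
  With \<open>r = 1 - P\<^sup>-\<^sup>1\<close> the sum is a truncated geometric series. The truncation is harmless because
  \<open>r\<close> has no constant term, and the full series sums to \<open>P = t / X\<close> times the series for \<open>k = 1\<close>.
\<close>

lemma sum_W1_eq_nsol: "(\<Sum>k = 1..n. W1 k n) = of_nat (nsol U_inv (Suc n))"
proof -
  define r where "r = 1 - inverse P_fps"
  have "fps_nth P_fps 0 = 1"
    by (simp add: P_fps_def P_coeff_def)
  then have P: "P_fps * (1 - r) = 1" and r0: "fps_nth r 0 = 0"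
    by (simp_all add: r_def inverse_mult_eq_1')
  have "(\<Sum>k = 1..n. W1 k n) = fps_nth (fps_X * root_series * (\<Sum>k<n. r ^ k)) n"
    unfolding W1_def W11_fps r_def[symmetric]
    by (simp add: sum.atLeast1_atMost_eq sum_distrib_left fps_sum_nth)
  also have "(\<Sum>k<n. r ^ k) = P_fps * (1 - r ^ n)"
    using one_diff_power_eq[of r n] P by (metis mult.assoc mult_1)
  also have "fps_X * root_series * (P_fps * (1 - r ^ n)) = edge_series * root_series - r ^ n * (edge_series * root_series)"
    by (simp add: edge_series_def algebra_simps)
  also have "fps_nth \<dots> n = fps_nth (edge_series * root_series) n"
  proof -
    have "fps_nth (r ^ n * (edge_series * root_series)) n = 0"
    proof -
      obtain r' where "r = fps_X * r'"
        using r0 fps_X_power_dvd_iff[of 1 r] by (auto simp: dvd_def)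
      then have "r ^ n * (edge_series * root_series) = fps_X ^ Suc n * (r' ^ n * P_fps * root_series)"
        by (simp add: edge_series_def power_mult_distrib mult_ac)
      then show ?thesis
        by (simp only: fps_X_power_mult_nth) simp
    qed
    then show ?thesis
      by simp
  qed
  also have "\<dots> = of_nat (nsol U_inv (Suc n))"
    by (simp add: nsol_U_inv mult.assoc)
  finally show ?thesis .
qed

lemma V_eq_nsol: "0 < k \<Longrightarrow> V k n = nsol (mat2 0 1 (-1) (int k)) (n + 1)"
  using nsol_last[of k "mat 1" "n + 1"] by (simp add: V_def)

lemma V_1_eq_nsol: "V 1 n = nsol U_inv (n + 1)"
  using V_eq_nsol[of 1 n] by (simp add: U_inv_def)

definition T_inv_pow :: "nat \<Rightarrow> int^2^2" where
  "T_inv_pow i = mat2 1 (- int i) 0 1"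

lemma stack_T_inv_pow:
  "eq_pm (stack_mat (replicate i 1 @ [2])) (T_inv_pow i)"
proof (induction i)
  case 0
  show ?case
    unfolding eq_pm_def by (intro disjI1 mat2_eqI) (simp_all add: rot_def T_inv_pow_def)
next
  case (Suc i)
  have "S_mat ** rot 1 = - T_inv_pow 1"
    by (rule mat2_eqI) (simp_all add: S_mat_def rot_def T_inv_pow_def)
  moreover have "stack_mat (replicate (Suc i) 1 @ [2]) = stack_mat (replicate i 1 @ [2]) ** (S_mat ** rot 1)"
    by (cases i) (simp_all add: matrix_mul_assoc)
  moreover have "T_inv_pow i ** T_inv_pow 1 = T_inv_pow (Suc i)"
    by (rule mat2_eqI) (simp_all add: T_inv_pow_def)
  ultimately show ?case
    using eq_pm_mult[OF Suc, of "T_inv_pow 1"] by (auto simp: eq_pm_def)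
qed

lemma weight_T_inv_pow:
  "weight (replicate i 1 @ [2]) = edge_series ^ (i + 2) * (branch_series ^ i * fps_X * root_series)"
proof (induction i)
  case (Suc i)
  have "weight (replicate (Suc i) 1 @ [2]) = branch_series * edge_series * weight (replicate i 1 @ [2])"
    by (cases i) simp_all
  with Suc show ?case
    by (simp add: mult_ac)
qed (simp add: mult_ac power2_eq_square)

lemma valid_T_inv_pow: "valid_stack (replicate i 1 @ [2])"
proof (induction i)
  case (Suc i)
  then show ?case
    by (cases i) simp_all
qed simp

text \<open>
  As \<open>T\<^sup>-\<^sup>i\<close> is \<open>(S U\<^sup>2)\<^sup>i\<close> up to sign, its weight is divisible by \<open>X t\<^sup>i\<^sup>+\<^sup>2\<close>. In terms of quiddities this bounds
  the last entry by the size minus 2.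
\<close>

lemma nsol_T_inv_pow_eq_0:
  assumes "n \<le> i + 2" "0 < i"
  shows "nsol (T_inv_pow i) n = 0"
proof -
  have "fps_nth (weight (replicate i 1 @ [2])) n = 0"
  proof -
    have "fps_nth (fps_X * (edge_series ^ (i + 2) * (branch_series ^ i * root_series))) n = 0"
      using assms edge_series_power_mult_nth_eq_0[of "n - 1" "i + 2"] by (cases n) auto
    then show ?thesis
      unfolding weight_T_inv_pow by (simp only: mult_ac)
  qed
  moreover have "replicate i 1 @ [2] \<noteq> [2 :: nat]"
    using assms by (cases i) auto
  ultimately have "of_nat (nsol (T_inv_pow i) n) = (0 :: rat)"
    using nsol_stack[OF valid_T_inv_pow, of i n] eq_pm_solutions[OF stack_T_inv_pow[of i], of n]
    by simp
  then show ?thesis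
    by simp
qed

text \<open>
  The solutions for \<open>T\<^sup>-\<^sup>i\<close> are the quiddities with last entry above \<open>i\<close>, lowered by \<open>i\<close>.
\<close>

lemma nsol_T_inv_pow:
  assumes "1 \<le> i" "1 \<le> n"
  shows "nsol (T_inv_pow i) (n + 1) = (\<Sum>d = i + 1..n - 1. V d (n - 1))"
proof (cases "i < n")
  case False
  then show ?thesis
    using nsol_T_inv_pow_eq_0[of "n + 1" i] assms by simp
next
  case True
  then have "i \<le> n - 1" by simp
  then show ?thesis using assms(1)
  proof (induction i rule: inc_induct)
    case base
    then show ?case
      using nsol_T_inv_pow_eq_0[of "n + 1" "n - 1"] assms by simp
  next
    case (step i)
    have "U_inv ** T_inv_pow i = mat2 0 1 (-1) (int (Suc i))" "T_inv ** T_inv_pow i = T_inv_pow (Suc i)"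
      by (rule mat2_eqI; simp add: U_inv_def T_inv_pow_def T_inv_def)+
    then have "nsol (T_inv_pow i) (n + 1) = V (i + 1) (n - 1) + nsol (T_inv_pow (Suc i)) (n + 1)"
      using nsol_split_last[of "T_inv_pow i" n] V_eq_nsol[of "i + 1" "n - 1"] assms by simp
    with step show ?case
      by (simp add: sum.atLeast_Suc_atMost)
  qed
qed

text \<open>
  For \<open>j = 0\<close> the matrix is \<open>T\<^sup>-\<^sup>1 S = S T S T\<close>. Stripping a first entry 1 leaves a solution for
  \<open>T\<^sup>-\<^sup>j\<^sup>-\<^sup>2\<close>, and lowering a larger first entry raises \<open>j\<close> by one; far out no solutions remain.
\<close>

lemma nsol_T_inv_S_SU_inv_pow:
  assumes "1 \<le> n" "j \<le> n"
  shows "nsol (T_inv_pow 1 ** S_mat ** mat2 1 0 (int j) 1) (n + 2) =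
    (\<Sum>d = j + 3..n - 1. (d - (j + 2)) * V d (n - 1))"
  using assms(2)
proof (induction j rule: inc_induct)
  case base
  have "eq_pm (stack_mat (2 # replicate (n + 1) 1 @ [2])) (T_inv_pow (n + 1) ** S_mat)"
    using eq_pm_mult[OF stack_T_inv_pow[of "n + 1"], of S_mat] by (simp add: rot_def)
  moreover have "T_inv_pow (n + 1) ** S_mat = T_inv_pow 1 ** S_mat ** mat2 1 0 (int n) 1"
    by (rule mat2_eqI) (simp_all add: T_inv_pow_def S_mat_def)
  ultimately have "solutions (T_inv_pow 1 ** S_mat ** mat2 1 0 (int n) 1) (n + 2) =
    solutions (stack_mat (2 # replicate (n + 1) 1 @ [2])) (n + 2)"
    using eq_pm_solutions by metis
  moreover have "valid_stack (2 # replicate (n + 1) 1 @ [2])"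
    using valid_T_inv_pow[of "n + 1"] by simp
  moreover have "fps_nth (weight (2 # replicate (n + 1) 1 @ [2])) (n + 2) = 0"
  proof -
    have "weight (2 # replicate (n + 1) 1 @ [2]) = edge_series ^ (n + 5) * (branch_series ^ (n + 2) * fps_X * root_series)"
      using weight_T_inv_pow[of "n + 1"] by (simp add: mult_ac eval_nat_numeral)
    then show ?thesis
      by (simp only: edge_series_power_mult_nth_eq_0)
  qed
  ultimately have "of_nat (nsol (T_inv_pow 1 ** S_mat ** mat2 1 0 (int n) 1) (n + 2)) = (0 :: rat)"
    using nsol_stack[of "2 # replicate (n + 1) 1 @ [2]" "n + 2"] by simp
  then show ?case
    by simp
next
  case (step j)
  let ?Y = "\<lambda>j. T_inv_pow 1 ** S_mat ** mat2 1 0 (int j) 1"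
  have "?Y j ** U_inv = T_inv_pow (j + 2)" "?Y j ** SU_inv = ?Y (Suc j)"
    by (rule mat2_eqI; simp add: U_inv_def T_inv_pow_def SU_inv_def S_mat_def)+
  then have "nsol (?Y j) (n + 2) = nsol (T_inv_pow (j + 2)) (n + 1) + nsol (?Y (Suc j)) (n + 2)"
    using nsol_split_hd[of "?Y j" "n + 1"] by simp
  also have "\<dots> = (\<Sum>d = j + 3..n - 1. V d (n - 1)) + (\<Sum>d = j + 4..n - 1. (d - (j + 3)) * V d (n - 1))"
    using nsol_T_inv_pow[of "j + 2" n] step assms by (simp add: eval_nat_numeral)
  also have "(\<Sum>d = j + 4..n - 1. (d - (j + 3)) * V d (n - 1)) = (\<Sum>d = j + 3..n - 1. (d - (j + 3)) * V d (n - 1))"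
    by (intro sum.mono_neutral_left) (auto simp: not_le)
  also have "(\<Sum>d = j + 3..n - 1. V d (n - 1)) + \<dots> = (\<Sum>d = j + 3..n - 1. (d - (j + 2)) * V d (n - 1))"
    unfolding sum.distrib[symmetric] by (intro sum.cong) (auto simp: le_iff_add)
  finally show ?case .
qed

section \<open>The five identities\<close>

theorem mainTheorem4:
  fixes u v w x y :: "nat \<Rightarrow> nat"
  assumes u: "\<And>n. n \<ge> 1 \<Longrightarrow> u n = card (solutions (matrix_inv T_mat) (n + 2))"
    and v: "\<And>n. n \<ge> 1 \<Longrightarrow> v n = card (solutions (T_mat ** S_mat) (n + 2))"
    and w: "\<And>n. n \<ge> 1 \<Longrightarrow> w n = card (solutions (S_mat ** T_mat) (n + 2))"
    and x: "\<And>n. n \<ge> 1 \<Longrightarrow> x n = card (solutions (T_mat ** S_mat ** T_mat ** S_mat) (n + 2))"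
    and y: "\<And>n. n \<ge> 1 \<Longrightarrow> y n = card (solutions (S_mat ** T_mat ** S_mat ** T_mat) (n + 2))"
  shows "(\<forall>n\<ge>1. int (u n) = int (Q n) - int (V 1 n))
    \<and> (v 1 = 0 \<and> (\<forall>n\<ge>2. v n = Q (n - 1) + S_count n))
    \<and> (\<forall>n\<ge>1. (of_nat (w n) :: rat) = of_nat (Q n) - 2 * (\<Sum>k = 1..n. W1 k n) + W1 1 n)
    \<and> (\<forall>n\<ge>1. x n = V 1 (n + 1))
    \<and> (y 1 = 0 \<and> y 2 = 0 \<and> y 3 = 0
        \<and> (\<forall>n\<ge>4. y n = (\<Sum>d = 3..n - 1. (d - 2) * V d (n - 1))))"
proof (intro conjI allI impI)
  have Q: "Q n = V 1 n + nsol T_inv (n + 2)" if "1 \<le> n" for n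
    using nsol_split_last[of "mat 1" "n + 1"] V_1_eq_nsol[of n] that by (simp add: Q_def)
  have u_eq: "u n = nsol T_inv (n + 2)" if "1 \<le> n" for n
    using u[OF that] by (simp add: matrix_inv_T_mat T_inv_def)
  show "int (u n) = int (Q n) - int (V 1 n)" if "1 \<le> n" for n
    using Q[OF that] u_eq[OF that] by simp

  have TS: "T_mat ** S_mat = mat2 1 (-1) 1 0"
    by (rule mat2_eqI) (simp_all add: T_mat_def S_mat_def)
  have "fps_nth (fps_X * root_series) 3 = 0"
  proof -
    have "fps_nth root_series 2 = fps_nth (1 + edge_series ^ 3 * root_series) 2"
      using root_series_eq by (rule arg_cong)
    then show ?thesis
      by (simp add: edge_series_power_mult_nth_eq_0 fps_X_mult_nth)
  qed
  then have "nsol (mat2 1 (-1) 1 0) 3 = 0"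
    using nsol_U[of 3] by simp
  then show "v 1 = 0"
    using v[of 1] by (simp add: TS numeral_3_eq_3)
  show "v n = Q (n - 1) + S_count n" if "2 \<le> n" for n
  proof -
    have "U_inv ** mat2 1 (-1) 1 0 = mat 1" "T_inv ** mat2 1 (-1) 1 0 = S_mat"
      by (rule mat2_eqI; simp add: U_inv_def T_inv_def S_mat_def)+
    then show ?thesis
      using v[of n] nsol_split_last[of "mat2 1 (-1) 1 0" "n + 1"] that
      by (simp add: TS Q_def S_count_def numeral_2_eq_2)
  qed

  show "(of_nat (w n) :: rat) = of_nat (Q n) - 2 * (\<Sum>k = 1..n. W1 k n) + W1 1 n" if "1 \<le> n" for n
  proof -
    have ST: "T_inv ** SU_inv = S_mat ** T_mat"
      by (rule mat2_eqI) (simp_all add: T_inv_def SU_inv_def S_mat_def T_mat_def)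
    have "U_inv ** U_inv = - mat2 1 (-1) 1 0"
      by (rule mat2_eqI) (simp_all add: U_inv_def)
    \<comment> \<open>Read as the number of quiddities whose first entry is 1, \<open>V 1 n\<close> splits by the last entry,
      just as \<open>nsol T_inv (n + 2)\<close>, where the last entry exceeds 1, splits by the first one.\<close>
    then have "V 1 n = nsol (mat2 1 (-1) 1 0) n + nsol (T_inv ** U_inv) (n + 1)"
      using nsol_split_last[of U_inv n] V_1_eq_nsol[of n] by simp
    moreover have "nsol T_inv (n + 2) = nsol (T_inv ** U_inv) (n + 1) + w n"
      using nsol_split_hd[of T_inv "n + 1"] w[OF that] by (simp add: ST)
    ultimately have "w n + 2 * V 1 n = Q n + nsol (mat2 1 (-1) 1 0) n"
      using Q[OF that] by simp
    then have "of_nat (w n + 2 * V 1 n) = (of_nat (Q n + nsol (mat2 1 (-1) 1 0) n) :: rat)"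
      by (rule arg_cong)
    moreover have "W1 1 n = of_nat (nsol (mat2 1 (-1) 1 0) n)"
      by (simp add: W1_def W11_eq_nsol)
    ultimately show ?thesis
      using sum_W1_eq_nsol[of n] V_1_eq_nsol[of n] by simp
  qed

  show "x n = V 1 (n + 1)" if "1 \<le> n" for n
  proof -
    have "T_mat ** S_mat ** T_mat ** S_mat = - U_inv"
      by (rule mat2_eqI) (simp_all add: T_mat_def S_mat_def U_inv_def)
    then show ?thesis
      using x[OF that] V_1_eq_nsol[of "n + 1"] by simp
  qed

  have y_sum: "y n = (\<Sum>d = 3..n - 1. (d - 2) * V d (n - 1))" if "1 \<le> n" for n
  proof -
    have "S_mat ** T_mat ** S_mat ** T_mat = T_inv_pow 1 ** S_mat ** mat2 1 0 (int 0) 1"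
      by (rule mat2_eqI) (simp_all add: T_mat_def S_mat_def T_inv_pow_def)
    then show ?thesis
      using y[OF that] nsol_T_inv_S_SU_inv_pow[of n 0] that by (simp add: numeral_2_eq_2)
  qed
  show "y 1 = 0" "y 2 = 0" "y 3 = 0"
    using y_sum[of 1] y_sum[of 2] y_sum[of 3] by simp_all
  show "y n = (\<Sum>d = 3..n - 1. (d - 2) * V d (n - 1))" if "4 \<le> n" for n
    using y_sum that by simp
qed

end
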